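(* Let $X$ be a separable, reflexive, asymptotic-$c_0$ Banach space. Then for every normalized $1$-suppression unconditional basic sequence $\bar e=(e_j)_j$ such that $\lim_{k\to\infty}\inf_{\mathbb M\in[\mathbb N]^\omega}\operatorname{diam}\big([\mathbb M]^k,d^{(k)}_{\bar e}\big)=\infty$ one has $\sup_{k\in\mathbb N}c_X\big([\mathbb N]^k,d^{(k)}_{\bar e}\big)=\infty$.
   Context: $[\mathbb M]^k$ is the set of $k$-element subsets of $\mathbb M$, $[\mathbb N]^\omega$ the set of infinite subsets of $\mathbb N$; elements $\bar m=\{m_1<\dots<m_k\}$. $(e_j)$ is $1$-suppression unconditional if $\|\sum_{j\in A}a_je_j\|\le\|\sum a_je_j\|$ for all finitely supported scalars and $A\subset\mathbb N$. $d^{(k)}_{\bar e}(\bar m,\bar n)=\|\sum_{j\in F}e_j\|$ with $F=\{j:m_j\ne n_j\}$. $c_X(M)$ is the infimum of $D\ge1$ for which there are $s>0$ and $f:M\to X$ with $s\,d(x,y)\le\|f(x)-f(y)\|\le sD\,d(x,y)$. $\{X\}_k$: norms $E$ on $\mathbb R^k$ with normalized monotone unit vector basis such that for every $\varepsilon>0$, for every closed finite-codimensional $X_1$ there is $x_1\in S_{X_1}$, ..., for every closed finite-codimensional $X_k$ there is $x_k\in S_{X_k}$ with $(x_j)$ $(1+\varepsilon)$-equivalent to $(e_j)$ (where $C$-equivalent means $\frac1A\|\sum a_ix_i\|\le\|\sum a_iy_i\|\le B\|\sum a_ix_i\|$ with $AB\le C$). $X$ is asymptotic-$c_0$ if for some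 $c$ all such bases are $c$-equivalent to the $\ell_\infty^k$ unit vector basis. *)

theory Defs
  imports "HOL-Analysis.Analysis"
begin

definition reflexive_space :: "'a::real_normed_vector itself \<Rightarrow> bool" where
  "reflexive_space _ \<longleftrightarrow>
     (\<forall>\<Phi> :: ('a \<Rightarrow>\<^sub>L real) \<Rightarrow>\<^sub>L real. \<exists>x::'a. \<forall>f. blinfun_apply \<Phi> f = blinfun_apply f x)"

definition closed_fin_codim :: "'a::real_normed_vector set \<Rightarrow> bool" where
  "closed_fin_codim Y \<longleftrightarrow> subspace Y \<and> closed Y \<and> (\<exists>F. finite F \<and> span (Y \<union> F) = UNIV)"

definition supported :: "nat \<Rightarrow> (nat \<Rightarrow> real) \<Rightarrow> bool" where
  "supported k a \<longleftrightarrow> (\<forall>j\<ge>k. a j = 0)"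

definition norm_on_Rk :: "nat \<Rightarrow> ((nat \<Rightarrow> real) \<Rightarrow> real) \<Rightarrow> bool" where
  "norm_on_Rk k E \<longleftrightarrow>
     (\<forall>a b. supported k a \<longrightarrow> supported k b \<longrightarrow> E (\<lambda>j. a j + b j) \<le> E a + E b) \<and>
     (\<forall>a c. supported k a \<longrightarrow> E (\<lambda>j. c * a j) = \<bar>c\<bar> * E a) \<and>
     (\<forall>a. supported k a \<longrightarrow> (E a = 0 \<longleftrightarrow> (\<forall>j. a j = 0)))"

text \<open>Normalized monotone unit vector basis (index j < k stands for the (j+1)-st unit vector).\<close>
definition normalized_monotone_norm :: "nat \<Rightarrow> ((nat \<Rightarrow> real) \<Rightarrow> real) \<Rightarrow> bool" where
  "normalized_monotone_norm k E \<longleftrightarrow> norm_on_Rk k E \<and>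
     (\<forall>j<k. E (\<lambda>i. if i = j then 1 else 0) = 1) \<and>
     (\<forall>a m. supported k a \<longrightarrow> m \<le> k \<longrightarrow> E (\<lambda>i. if i < m then a i else 0) \<le> E a)"

definition C_equiv :: "nat \<Rightarrow> ((nat \<Rightarrow> real) \<Rightarrow> real) \<Rightarrow> ((nat \<Rightarrow> real) \<Rightarrow> real) \<Rightarrow> real \<Rightarrow> bool" where
  "C_equiv k N1 N2 C \<longleftrightarrow> (\<exists>A B. A > 0 \<and> B > 0 \<and> A * B \<le> C \<and>
     (\<forall>a. supported k a \<longrightarrow> N1 a / A \<le> N2 a \<and> N2 a \<le> B * N1 a))"

definition seq_norm :: "nat \<Rightarrow> 'a::real_normed_vector list \<Rightarrow> (nat \<Rightarrow> real) \<Rightarrow> real" where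
  "seq_norm k xs a = norm (\<Sum>j<k. a j *\<^sub>R (xs ! j))"

fun asym_game :: "nat \<Rightarrow> ('a::real_normed_vector list \<Rightarrow> bool) \<Rightarrow> 'a list \<Rightarrow> bool" where
  "asym_game 0 P xs = P xs"
| "asym_game (Suc n) P xs =
     (\<forall>Y. closed_fin_codim Y \<longrightarrow> (\<exists>x\<in>Y. norm x = 1 \<and> asym_game n P (xs @ [x])))"

definition asym_structure :: "'a::real_normed_vector itself \<Rightarrow> nat \<Rightarrow> ((nat \<Rightarrow> real) \<Rightarrow> real) set" where
  "asym_structure _ k = {E. normalized_monotone_norm k E \<and>
     (\<forall>\<epsilon>>0. asym_game k (\<lambda>xs::'a list. C_equiv k (seq_norm k xs) E (1 + \<epsilon>)) [])}"

definition linf_norm :: "nat \<Rightarrow> (nat \<Rightarrow> real) \<Rightarrow> real" where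
  "linf_norm k a = Max (insert 0 ((\<lambda>j. \<bar>a j\<bar>) ` {..<k}))"

definition asymptotic_c0 :: "'a::real_normed_vector itself \<Rightarrow> bool" where
  "asymptotic_c0 X \<longleftrightarrow> (\<exists>c. \<forall>k. \<forall>E\<in>asym_structure X k. C_equiv k (linf_norm k) E c)"

definition normalized_seq :: "(nat \<Rightarrow> 'b::real_normed_vector) \<Rightarrow> bool" where
  "normalized_seq e \<longleftrightarrow> (\<forall>j. norm (e j) = 1)"

definition basic_seq :: "(nat \<Rightarrow> 'b::real_normed_vector) \<Rightarrow> bool" where
  "basic_seq e \<longleftrightarrow> (\<forall>x\<in>closure (span (range e)).
      \<exists>!a::nat \<Rightarrow> real. (\<lambda>n. \<Sum>j<n. a j *\<^sub>R e j) \<longlonglongrightarrow> x)"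

text \<open>1-suppression unconditional (finitely supported scalars = supported on some {..<n}).\<close>
definition suppression_unconditional1 :: "(nat \<Rightarrow> 'b::real_normed_vector) \<Rightarrow> bool" where
  "suppression_unconditional1 e \<longleftrightarrow>
     (\<forall>(a::nat \<Rightarrow> real) A n. norm (\<Sum>j\<in>A \<inter> {..<n}. a j *\<^sub>R e j) \<le> norm (\<Sum>j<n. a j *\<^sub>R e j))"

definition ksubsets :: "nat set \<Rightarrow> nat \<Rightarrow> nat set set" where
  "ksubsets M k = {A. A \<subseteq> M \<and> finite A \<and> card A = k}"

text \<open>d_e^(k)(m,n) = || sum_{j in F} e_j ||, F = {j : m_j \<noteq> n_j}; positions j are 0-based
  (the (j+1)-st smallest element), and e j stands for e_{j+1}.\<close>
definition d_e :: "(nat \<Rightarrow> 'b::real_normed_vector) \<Rightarrow> nat \<Rightarrow> nat set \<Rightarrow> nat set \<Rightarrow> real" where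
  "d_e e k A B = norm (\<Sum>j\<in>{j. j < k \<and> sorted_list_of_set A ! j \<noteq> sorted_list_of_set B ! j}. e j)"

definition diam_k :: "(nat \<Rightarrow> 'b::real_normed_vector) \<Rightarrow> nat \<Rightarrow> nat set \<Rightarrow> real" where
  "diam_k e k M = Sup {d_e e k A B | A B. A \<in> ksubsets M k \<and> B \<in> ksubsets M k}"

text \<open>c_X([N]^k, d_e^(k)) as an extended real (infimum of the empty set is \<infinity>).\<close>
definition c_dist :: "'a::real_normed_vector itself \<Rightarrow> (nat \<Rightarrow> 'b::real_normed_vector) \<Rightarrow> nat \<Rightarrow> ereal" where
  "c_dist _ e k = Inf (ereal ` {D. D \<ge> 1 \<and> (\<exists>s>0. \<exists>f :: nat set \<Rightarrow> 'a.
      \<forall>A\<in>ksubsets UNIV k. \<forall>B\<in>ksubsets UNIV k.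
        s * d_e e k A B \<le> norm (f A - f B) \<and> norm (f A - f B) \<le> s * D * d_e e k A B)})"

end

theory Submission
  imports Defs
begin

text \<open>For every infinite \<open>M\<close> the diameter of \<open>[M]^k\<close> is the norm of \<open>e 0 + \<dots> + e (k-1)\<close>, the distance of
  any two sets differing in all positions; so it suffices to find two separated \<open>k\<close>-sets whose images
  under a map that is \<open>L\<close>-Lipschitz for changes of one coordinate are at distance at most
  \<open>2 L (2 C + 1)\<close>, with \<open>C\<close> independent of \<open>k\<close>.

  Taking iterated weak limits of the map along a free ultrafilter on the last indices (reflexivity)
  writes its values, up to a constant vector, as sums of increments of norm at most \<open>L\<close>, each weakly
  null in its last index. Such increments are nearly legal moves in the asymptotic game. The outcome
  properties that the subspace player can enforce form a filter, and the limit of the outcome norms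
  along any finer ultrafilter lies in the asymptotic structure. Hence in an asymptotic-\<open>c\<^sub>0\<close>
  space the subspace player can keep all sums with coefficients in \<open>[-1, 1]\<close> bounded by
  some \<open>C\<close>, and playing this strategy against the increments yields branches on which the map stays
  near a fixed vector.\<close>

subsection \<open>A Hahn-Banach theorem\<close>

definition sublinear :: "('a::real_vector \<Rightarrow> real) \<Rightarrow> bool" where
  "sublinear p \<longleftrightarrow> (\<forall>x y. p (x + y) \<le> p x + p y) \<and> (\<forall>t\<ge>0. \<forall>x. p (t *\<^sub>R x) = t * p x)"

text \<open>Homogeneity reverses itself: the third assumption with factor \<open>1 / t\<close> at
  \<open>t *\<^sub>R x\<close> gives the missing inequality.\<close>

lemma sublinearI:
  assumes "\<And>x y. p (x + y) \<le> p x + p y" and "p 0 = 0"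
    and "\<And>t x. t > 0 \<Longrightarrow> p (t *\<^sub>R x) \<le> t * p x"
  shows "sublinear p"
proof -
  have "p (t *\<^sub>R x) = t * p x" if "t \<ge> 0" for t x
  proof (cases "t = 0")
    case False
    with that have t: "t > 0" by simp
    have "p ((1 / t) *\<^sub>R (t *\<^sub>R x)) \<le> (1 / t) * p (t *\<^sub>R x)"
      by (rule assms(3)) (use t in simp)
    then have "p x \<le> (1 / t) * p (t *\<^sub>R x)" using t by simp
    then have "t * p x \<le> p (t *\<^sub>R x)" using t by (simp add: field_simps)
    with assms(3)[OF t, of x] show ?thesis by simp
  qed (simp add: assms(2))
  with assms(1) show ?thesis unfolding sublinear_def by blast
qed

lemma sublinear_add: "sublinear p \<Longrightarrow> p (x + y) \<le> p x + p y"
  and sublinear_scale: "sublinear p \<Longrightarrow> t \<ge> 0 \<Longrightarrow> p (t *\<^sub>R x) = t * p x"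
  by (auto simp: sublinear_def)

lemma sublinear_0: "sublinear p \<Longrightarrow> p 0 = 0"
  using sublinear_scale[of p 0 0] by simp

lemma sublinear_ge_minus: "sublinear p \<Longrightarrow> - p (- x) \<le> p x"
  using sublinear_add[of p x "-x"] sublinear_0[of p] by simp

lemma sublinear_norm: "sublinear norm"
  by (auto simp: sublinear_def norm_triangle_ineq)

text \<open>The infimum over \<open>t \<ge> 0\<close> of
  \<open>p (x + t *\<^sub>R v) - t * p v\<close> is sublinear, and \<open>t = 1\<close> gives the
  value at \<open>- v\<close>. A minimal sublinear functional coincides with its lowering, so it is
  odd and hence linear.\<close>

lemma sublinear_lower:
  assumes p: "sublinear p"
  shows "\<exists>q. sublinear q \<and> q \<le> p \<and> q (- v) \<le> - p v"
proof -
  define h where "h x t = p (x + t *\<^sub>R v) - t * p v" for x t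
  define q where "q x = (INF t\<in>{0..}. h x t)" for x
  have bdd: "bdd_below (h x ` {0..})" for x
  proof (rule bdd_belowI2)
    fix t :: real assume "t \<in> {0..}"
    then show "- p (- x) \<le> h x t"
      using sublinear_add[OF p, of "x + t *\<^sub>R v" "- x"] sublinear_scale[OF p, of t v]
      by (simp add: h_def)
  qed
  have qh: "q x \<le> h x t" if "t \<ge> 0" for x t
    unfolding q_def by (rule cINF_lower[OF bdd]) (use that in simp)
  have hq: "a \<le> q x" if "\<And>t. t \<ge> 0 \<Longrightarrow> a \<le> h x t" for a x
    unfolding q_def by (rule cINF_greatest) (use that in auto)
  have "sublinear q"
  proof (rule sublinearI)
    fix x y
    have "q (x + y) - h y t \<le> q x" if t: "t \<ge> 0" for t
    proof (rule hq)
      fix s :: real assume s: "s \<ge> 0"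
      have "q (x + y) \<le> h (x + y) (s + t)" using qh s t by simp
      also have "\<dots> \<le> h x s + h y t"
        using sublinear_add[OF p, of "x + s *\<^sub>R v" "y + t *\<^sub>R v"]
        by (simp add: h_def algebra_simps)
      finally show "q (x + y) - h y t \<le> h x s" by simp
    qed
    then have "q (x + y) - q x \<le> q y" by (intro hq) (simp add: algebra_simps)
    then show "q (x + y) \<le> q x + q y" by simp
  next
    have "h 0 t = 0" if "t \<ge> 0" for t using sublinear_scale[OF p that] by (simp add: h_def)
    then show "q 0 = 0" using qh[of 0 0] hq[of 0 0] by simp
  next
    fix t :: real and x assume t: "t > 0"
    have "q (t *\<^sub>R x) / t \<le> q x"
    proof (rule hq)
      fix s :: real assume s: "s \<ge> 0"
      have "q (t *\<^sub>R x) \<le> h (t *\<^sub>R x) (t * s)" using qh s t by simp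
      also have "\<dots> = t * h x s"
        using sublinear_scale[OF p, of t "x + s *\<^sub>R v"] t by (simp add: h_def algebra_simps)
      finally show "q (t *\<^sub>R x) / t \<le> h x s" using t by (simp add: field_simps)
    qed
    then show "q (t *\<^sub>R x) \<le> t * q x" using t by (simp add: field_simps)
  qed
  moreover have "q \<le> p" using qh[of 0] by (auto simp: le_fun_def h_def)
  moreover have "q (- v) \<le> - p v" using qh[of 1 "- v"] sublinear_0[OF p] by (simp add: h_def)
  ultimately show ?thesis by blast
qed

text \<open>Zorn's lemma for the reversed pointwise order. The pointwise infimum of a chain is
  subadditive because of two members the smaller one can serve at both \<open>x\<close> and
  \<open>y\<close>.\<close>

lemma minimal_sublinear_exists:
  fixes p :: "'a::real_vector \<Rightarrow> real"
  assumes p: "sublinear p"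
  shows "\<exists>m. sublinear m \<and> m \<le> p \<and> (\<forall>q. sublinear q \<and> q \<le> m \<longrightarrow> q = m)"
proof -
  define A where "A = {q. sublinear q \<and> q \<le> p}"
  have "\<exists>m\<in>A. \<forall>q\<in>A. q \<le> m \<longrightarrow> q = m"
  proof (rule predicate_Zorn)
    show "partial_order_on A (relation_of (\<lambda>x y. y \<le> x) A)"
      by (rule partial_order_on_relation_ofI) auto
  next
    fix C assume "C \<in> Chains (relation_of (\<lambda>x y. y \<le> x) A)"
    then have CA: "C \<subseteq> A" and tot: "\<And>q r. q \<in> C \<Longrightarrow> r \<in> C \<Longrightarrow> q \<le> r \<or> r \<le> q"
      by (auto simp: Chains_def relation_of_def)
    show "\<exists>u\<in>A. \<forall>a\<in>C. u \<le> a"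
    proof (cases "C = {}")
      case True
      then show ?thesis using p by (auto simp: A_def)
    next
      case False
      define u where "u x = (INF q\<in>C. q x)" for x
      have sub: "sublinear q" and le: "q \<le> p" if "q \<in> C" for q
        using that CA by (auto simp: A_def)
      have bdd: "bdd_below ((\<lambda>q. q x) ` C)" for x
      proof (rule bdd_belowI2)
        fix q assume "q \<in> C"
        then show "- p (- x) \<le> q x"
          using sublinear_ge_minus[OF sub, of q x] le_funD[OF le, of q "- x"] by linarith
      qed
      have uq: "u x \<le> q x" if "q \<in> C" for q x
        unfolding u_def by (rule cINF_lower[OF bdd that])
      have qu: "a \<le> u x" if "\<And>q. q \<in> C \<Longrightarrow> a \<le> q x" for a x
        unfolding u_def by (rule cINF_greatest) (use that False in auto)
      have "sublinear u"
      proof (rule sublinearI)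
        fix x y
        have "u (x + y) - r y \<le> u x" if r: "r \<in> C" for r
        proof (rule qu)
          fix q assume q: "q \<in> C"
          have "u (x + y) \<le> q x + r y"
            using tot[OF q r]
          proof
            assume "q \<le> r"
            then show ?thesis using uq[OF q, of "x + y"] sublinear_add[OF sub[OF q], of x y]
                le_funD[of q r y] by linarith
          next
            assume "r \<le> q"
            then show ?thesis using uq[OF r, of "x + y"] sublinear_add[OF sub[OF r], of x y]
                le_funD[of r q x] by linarith
          qed
          then show "u (x + y) - r y \<le> q x" by simp
        qed
        then have "u (x + y) - u x \<le> u y" by (intro qu) (simp add: algebra_simps)
        then show "u (x + y) \<le> u x + u y" by simp
      next
        have "u 0 = (INF q\<in>C. 0)" unfolding u_def by (rule INF_cong) (auto simp: sublinear_0 sub)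
        then show "u 0 = 0" using False by simp
      next
        fix t :: real and x assume t: "t > 0"
        have "u (t *\<^sub>R x) / t \<le> u x"
        proof (rule qu)
          fix q assume q: "q \<in> C"
          have "u (t *\<^sub>R x) \<le> t * q x"
            using uq[OF q, of "t *\<^sub>R x"] sublinear_scale[OF sub[OF q], of t x] t by simp
          then show "u (t *\<^sub>R x) / t \<le> q x" using t by (simp add: field_simps)
        qed
        then show "u (t *\<^sub>R x) \<le> t * u x" using t by (simp add: field_simps)
      qed
      moreover obtain q where q: "q \<in> C" using False by blast
      have "u x \<le> p x" for x using uq[OF q, of x] le_funD[OF le[OF q], of x] by simp
      then have "u \<le> p" by (rule le_funI)
      ultimately show ?thesis using uq by (auto simp: A_def le_fun_def)
    qed
  qed
  then obtain m where m: "m \<in> A" and min: "\<forall>q\<in>A. q \<le> m \<longrightarrow> q = m" by blast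
  have "q \<in> A" if "sublinear q" "q \<le> m" for q
    using m that order_trans[of q m p] by (simp add: A_def)
  with m min show ?thesis by (auto simp: A_def)
qed

text \<open>Lowering the norm in direction \<open>v\<close> forces every functional \<open>m\<close>
  below the result to satisfy \<open>m (- v) \<le> - norm v\<close>. A minimal such \<open>m\<close>
  is linear, and then \<open>m v = norm v\<close>.\<close>

lemma norming_functional_exists:
  fixes v :: "'a::real_normed_vector"
  shows "\<exists>\<phi>::'a \<Rightarrow>\<^sub>L real. blinfun_apply \<phi> v = norm v \<and> (\<forall>x. \<bar>blinfun_apply \<phi> x\<bar> \<le> norm x)"
proof -
  obtain q :: "'a \<Rightarrow> real" where q: "sublinear q" "q \<le> norm" "q (- v) \<le> - norm v"
    using sublinear_lower[OF sublinear_norm] by blast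
  obtain m where m: "sublinear m" "m \<le> q" and min: "\<And>r. sublinear r \<Longrightarrow> r \<le> m \<Longrightarrow> r = m"
    using minimal_sublinear_exists[OF q(1)] by blast
  have neg: "m (- x) = - m x" for x
  proof -
    obtain r where "sublinear r" "r \<le> m" "r (- x) \<le> - m x"
      using sublinear_lower[OF m(1)] by blast
    with min have "m (- x) \<le> - m x" by metis
    then show ?thesis using sublinear_ge_minus[OF m(1), of x] by simp
  qed
  have add: "m (x + y) = m x + m y" for x y
    using sublinear_add[OF m(1), of x y] sublinear_add[OF m(1), of "x + y" "- y"] neg[of y] by simp
  have scale: "m (t *\<^sub>R x) = t * m x" for t x
    using sublinear_scale[OF m(1), of t x] sublinear_scale[OF m(1), of "- t" x] neg[of "t *\<^sub>R x"]
    by (cases "t \<ge> 0") auto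
  have le: "m x \<le> norm x" for x using le_funD[OF m(2), of x] le_funD[OF q(2), of x] by simp
  have bound: "\<bar>m x\<bar> \<le> norm x" for x using le[of x] le[of "- x"] neg[of x] by auto
  have bl: "bounded_linear m"
    by (rule bounded_linear_intro[where K = 1]) (simp_all add: add scale bound)
  have "m (- v) \<le> - norm v" using le_funD[OF m(2), of "- v"] q(3) by simp
  then have "m v = norm v" using neg[of v] le[of v] by simp
  then show ?thesis using bound bounded_linear_Blinfun_apply[OF bl] by (intro exI[of _ "Blinfun m"]) simp
qed

subsection \<open>Ultrafilters\<close>

definition ultra :: "'a filter \<Rightarrow> bool" where
  "ultra U \<longleftrightarrow> U \<noteq> bot \<and> (\<forall>P. eventually P U \<or> eventually (\<lambda>x. \<not> P x) U)"

text \<open>A minimal proper filter decides every \<open>P\<close>, since its restriction to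
  \<open>P\<close> is either trivial or the filter itself. Zorn's lemma applies because a property
  eventual along the infimum of a nonempty chain is already eventual along a member, so the infimum
  stays proper.\<close>

lemma ultra_exists:
  fixes F :: "'a filter"
  assumes "F \<noteq> bot"
  shows "\<exists>U\<le>F. ultra U"
proof -
  define A where "A = {G. G \<noteq> bot \<and> G \<le> F}"
  have "\<exists>m\<in>A. \<forall>q\<in>A. q \<le> m \<longrightarrow> q = m"
  proof (rule predicate_Zorn)
    show "partial_order_on A (relation_of (\<lambda>x y. y \<le> x) A)"
      by (rule partial_order_on_relation_ofI) auto
  next
    fix C assume "C \<in> Chains (relation_of (\<lambda>x y. y \<le> x) A)"
    then have CA: "C \<subseteq> A" and tot: "\<And>q r. q \<in> C \<Longrightarrow> r \<in> C \<Longrightarrow> q \<le> r \<or> r \<le> q"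
      by (auto simp: Chains_def relation_of_def)
    show "\<exists>u\<in>A. \<forall>a\<in>C. u \<le> a"
    proof (cases "C = {}")
      case True
      then show ?thesis using assms by (auto simp: A_def)
    next
      case False
      have "eventually P (Inf C) \<longleftrightarrow> (\<exists>b\<in>C. eventually P b)" for P
        by (rule eventually_Inf_base[OF False]) (metis tot inf.absorb1 inf.absorb2 order_refl)
      then have "Inf C \<noteq> bot" using CA by (auto simp: trivial_limit_def A_def)
      moreover have "Inf C \<le> F" using False CA by (force simp: A_def intro: Inf_lower2)
      ultimately show ?thesis by (auto simp: A_def intro: Inf_lower)
    qed
  qed
  then obtain U where U: "U \<noteq> bot" "U \<le> F" and min: "\<And>G. G \<noteq> bot \<Longrightarrow> G \<le> U \<Longrightarrow> G = U"
    unfolding A_def by (metis (mono_tags, lifting) mem_Collect_eq order_trans)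
  have "eventually P U \<or> eventually (\<lambda>x. \<not> P x) U" for P
  proof (cases "inf U (principal {x. P x}) = bot")
    case True
    then show ?thesis by (simp add: trivial_limit_def eventually_inf_principal)
  next
    case False
    then have "inf U (principal {x. P x}) = U" using min by simp
    moreover have "eventually P (inf U (principal {x. P x}))" by (simp add: eventually_inf_principal)
    ultimately show ?thesis by simp
  qed
  with U show ?thesis by (auto simp: ultra_def)
qed

text \<open>Compactness of \<open>{-B..B}\<close> gives a cluster point of the image filter, and a
  cluster point of an ultrafilter is a limit.\<close>

lemma ultra_bounded_convergent:
  fixes g :: "'a \<Rightarrow> real"
  assumes U: "ultra U" and bdd: "eventually (\<lambda>n. \<bar>g n\<bar> \<le> B) U"
  shows "\<exists>l. (g \<longlongrightarrow> l) U"
proof -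
  have "eventually (\<lambda>x. x \<in> {-B..B}) (filtermap g U)"
    using bdd by (simp add: eventually_filtermap abs_le_iff minus_le_iff conj_commute)
  moreover have "filtermap g U \<noteq> bot" using U by (simp add: ultra_def filtermap_bot_iff)
  ultimately obtain l where l: "inf (nhds l) (filtermap g U) \<noteq> bot"
    using compact_Icc[of "-B" B] unfolding compact_filter by blast
  have "(g \<longlongrightarrow> l) U"
  proof (rule topological_tendstoI)
    fix S assume S: "open S" "l \<in> S"
    show "eventually (\<lambda>x. g x \<in> S) U"
    proof (rule ccontr)
      assume "\<not> ?thesis"
      then have "eventually (\<lambda>x. g x \<notin> S) U" using U by (auto simp: ultra_def)
      then have "eventually (\<lambda>y. y \<notin> S) (filtermap g U)" by (simp add: eventually_filtermap)
      moreover have "eventually (\<lambda>y. y \<in> S) (nhds l)" using S by (rule eventually_nhds_in_open)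
      ultimately have "eventually (\<lambda>_. False) (inf (nhds l) (filtermap g U))"
        unfolding eventually_inf by blast
      with l show False by (simp add: trivial_limit_def)
    qed
  qed
  then show ?thesis by blast
qed

lemma ultra_Lim:
  fixes g :: "'a \<Rightarrow> real"
  assumes "ultra U" and "eventually (\<lambda>n. \<bar>g n\<bar> \<le> B) U"
  shows "(g \<longlongrightarrow> Lim U g) U"
  using ultra_bounded_convergent[OF assms] assms(1) by (auto simp: ultra_def tendsto_Lim)

subsection \<open>Weak limits along an ultrafilter\<close>

definition weak_lim :: "'i filter \<Rightarrow> ('i \<Rightarrow> 'a::real_normed_vector) \<Rightarrow> 'a \<Rightarrow> bool" where
  "weak_lim U u x \<longleftrightarrow> (\<forall>\<phi>::'a \<Rightarrow>\<^sub>L real. ((\<lambda>n. blinfun_apply \<phi> (u n)) \<longlongrightarrow> blinfun_apply \<phi> x) U)"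

text \<open>The limits of \<open>blinfun_apply \<phi> (u n)\<close> depend linearly and boundedly on
  \<open>\<phi>\<close>; they form an element of the bidual, which reflexivity represents by a
  vector.\<close>

lemma weak_lim_exists:
  fixes u :: "'i \<Rightarrow> 'a::real_normed_vector"
  assumes refl: "reflexive_space TYPE('a)" and U: "ultra U" and bdd: "\<And>n. norm (u n) \<le> K"
  shows "\<exists>x. weak_lim U u x"
proof -
  define \<Phi> :: "('a \<Rightarrow>\<^sub>L real) \<Rightarrow> real" where "\<Phi> \<phi> = Lim U (\<lambda>n. blinfun_apply \<phi> (u n))" for \<phi>
  have U0: "U \<noteq> bot" using U by (simp add: ultra_def)
  have b: "\<bar>blinfun_apply \<phi> (u n)\<bar> \<le> norm \<phi> * K" for \<phi> n
    using norm_blinfun[of \<phi> "u n"] mult_left_mono[OF bdd[of n] norm_ge_zero[of \<phi>]] by simp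
  have lim: "((\<lambda>n. blinfun_apply \<phi> (u n)) \<longlongrightarrow> \<Phi> \<phi>) U" for \<phi>
    unfolding \<Phi>_def by (rule ultra_Lim[OF U]) (rule always_eventually, use b in blast)
  have "bounded_linear \<Phi>"
  proof (rule bounded_linear_intro[where K = K])
    fix \<phi> \<psi> :: "'a \<Rightarrow>\<^sub>L real"
    have "((\<lambda>n. blinfun_apply (\<phi> + \<psi>) (u n)) \<longlongrightarrow> \<Phi> \<phi> + \<Phi> \<psi>) U"
      using tendsto_add[OF lim lim] by (simp add: blinfun.bilinear_simps)
    then show "\<Phi> (\<phi> + \<psi>) = \<Phi> \<phi> + \<Phi> \<psi>" using tendsto_unique[OF U0 lim] by blast
  next
    fix r and \<phi> :: "'a \<Rightarrow>\<^sub>L real"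
    have "((\<lambda>n. blinfun_apply (r *\<^sub>R \<phi>) (u n)) \<longlongrightarrow> r *\<^sub>R \<Phi> \<phi>) U"
      using tendsto_scaleR[OF tendsto_const lim] by (simp add: blinfun.bilinear_simps)
    then show "\<Phi> (r *\<^sub>R \<phi>) = r *\<^sub>R \<Phi> \<phi>" using tendsto_unique[OF U0 lim] by blast
  next
    fix \<phi> :: "'a \<Rightarrow>\<^sub>L real"
    have "\<bar>\<Phi> \<phi>\<bar> \<le> norm \<phi> * K"
      by (rule tendsto_upperbound[OF tendsto_rabs[OF lim] _ U0]) (simp add: b)
    then show "norm (\<Phi> \<phi>) \<le> norm \<phi> * K" by simp
  qed
  then have \<Phi>: "blinfun_apply (Blinfun \<Phi>) = \<Phi>" by (rule bounded_linear_Blinfun_apply)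
  obtain x where "\<forall>\<phi>. blinfun_apply (Blinfun \<Phi>) \<phi> = blinfun_apply \<phi> x"
    using refl unfolding reflexive_space_def by blast
  then show ?thesis using lim unfolding \<Phi> weak_lim_def by (intro exI[of _ x]) metis
qed

text \<open>Weak lower semicontinuity of the norm, tested on a functional norming the limit.\<close>

lemma weak_lim_norm_le:
  fixes u :: "'i \<Rightarrow> 'a::real_normed_vector"
  assumes lim: "weak_lim U u x" and U: "U \<noteq> bot" and bdd: "eventually (\<lambda>n. norm (u n) \<le> K) U"
  shows "norm x \<le> K"
proof -
  obtain \<phi> :: "'a \<Rightarrow>\<^sub>L real" where \<phi>: "blinfun_apply \<phi> x = norm x"
      "\<And>y. \<bar>blinfun_apply \<phi> y\<bar> \<le> norm y"
    using norming_functional_exists[of x] by blast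
  have "((\<lambda>n. blinfun_apply \<phi> (u n)) \<longlongrightarrow> norm x) U" using lim \<phi>(1) by (metis weak_lim_def)
  then show ?thesis
  proof (rule tendsto_upperbound[OF _ _ U])
    show "eventually (\<lambda>n. blinfun_apply \<phi> (u n) \<le> K) U"
      using bdd by eventually_elim (use \<phi>(2) in \<open>meson abs_le_D1 order_trans\<close>)
  qed
qed

lemma weak_lim_diff:
  assumes "weak_lim U u x" and "weak_lim U v y"
  shows "weak_lim U (\<lambda>n. u n - v n) (x - y)"
  using assms by (auto simp: weak_lim_def blinfun.bilinear_simps intro: tendsto_diff)

lemma weak_lim_const: "weak_lim U (\<lambda>_. x) x"
  by (simp add: weak_lim_def)

subsection \<open>Closed subspaces of finite codimension\<close>

text \<open>Here \<open>d\<close> is the radius of a ball around \<open>v\<close> missing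
  \<open>Y\<close>. The bound makes the coefficient along \<open>v\<close> modulo \<open>Y\<close>
  unique and continuous.\<close>

lemma closed_subspace_dist_bound:
  fixes Y :: "'a::real_normed_vector set"
  assumes sY: "subspace Y" and cY: "closed Y" and v: "v \<notin> Y"
  shows "\<exists>d>0. \<forall>x t. x - t *\<^sub>R v \<in> Y \<longrightarrow> \<bar>t\<bar> * d \<le> norm x"
proof -
  obtain d where d: "d > 0" "ball v d \<subseteq> - Y"
    using cY v open_contains_ball[of "- Y"] by auto
  have "\<bar>t\<bar> * d \<le> norm x" if "x - t *\<^sub>R v \<in> Y" for x t
  proof (cases "t = 0")
    case False
    have "(- 1 / t) *\<^sub>R (x - t *\<^sub>R v) \<in> Y" by (rule subspace_scale[OF sY that])
    then have "v - (1 / t) *\<^sub>R x \<in> Y" using False by (simp add: algebra_simps)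
    then have "dist v (v - (1 / t) *\<^sub>R x) \<ge> d" using d by (meson ComplD mem_ball not_le subsetD)
    then have "d \<le> norm x / \<bar>t\<bar>" by (simp add: dist_norm)
    then show ?thesis using False by (simp add: field_simps)
  qed simp
  with d show ?thesis by blast
qed

text \<open>If \<open>v\<close> is outside \<open>Y\<close>, the coefficients of \<open>v\<close>
  along a convergent sequence are Cauchy by the distance bound, so the limit splits in the same
  way.\<close>

lemma closed_span_insert:
  fixes Y :: "'a::real_normed_vector set"
  assumes sY: "subspace Y" and cY: "closed Y"
  shows "closed (span (insert v Y))"
proof (cases "v \<in> Y")
  case True
  then show ?thesis using assms by (simp add: insert_absorb span_eq_iff[THEN iffD2])
next
  case False
  obtain d where d: "d > 0" "\<And>x t. x - t *\<^sub>R v \<in> Y \<Longrightarrow> \<bar>t\<bar> * d \<le> norm x"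
    using closed_subspace_dist_bound[OF sY cY False] by blast
  have mem: "x \<in> span (insert v Y) \<longleftrightarrow> (\<exists>t. x - t *\<^sub>R v \<in> Y)" for x
    using sY by (simp add: span_breakdown_eq span_eq_iff[THEN iffD2])
  show ?thesis unfolding closed_sequential_limits
  proof safe
    fix x l assume x: "\<forall>n. x n \<in> span (insert v Y)" and l: "x \<longlonglongrightarrow> l"
    then obtain t where t: "\<And>n. x n - t n *\<^sub>R v \<in> Y" unfolding mem by metis
    have dist: "\<bar>t m - t n\<bar> * d \<le> norm (x m - x n)" for m n
      using d(2)[of "x m - x n" "t m - t n"] subspace_diff[OF sY t[of m] t[of n]]
      by (simp add: algebra_simps)
    have "Cauchy t"
    proof (rule CauchyI)
      fix r :: real assume "r > 0"
      then obtain M where "\<And>m n. m \<ge> M \<Longrightarrow> n \<ge> M \<Longrightarrow> norm (x m - x n) < r * d"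
        using CauchyD[OF LIMSEQ_imp_Cauchy[OF l], of "r * d"] d(1) by auto
      then have "\<bar>t m - t n\<bar> * d < r * d" if "m \<ge> M" "n \<ge> M" for m n
        using dist[of m n] that by (meson le_less_trans)
      then show "\<exists>M. \<forall>m\<ge>M. \<forall>n\<ge>M. norm (t m - t n) < r"
        using d(1) by (intro exI[of _ M]) simp
    qed
    then obtain s where "t \<longlonglongrightarrow> s" using real_Cauchy_convergent convergent_def by blast
    then have "(\<lambda>n. x n - t n *\<^sub>R v) \<longlonglongrightarrow> l - s *\<^sub>R v" by (intro tendsto_intros l)
    then have "l - s *\<^sub>R v \<in> Y" by (rule closed_sequentially[OF cY, rotated]) (rule t)
    then show "l \<in> span (insert v Y)" unfolding mem by blast
  qed
qed

text \<open>A bounded finite-rank correction moves every vector into \<open>Y\<close>. The induction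
  trades a vector of \<open>F\<close> for a larger subspace: after correction into
  \<open>span (insert v Y)\<close>, the coefficient of the remainder along \<open>v\<close> is a
  bounded functional and is appended to the list.\<close>

lemma fin_codim_functionals:
  fixes Y :: "'a::real_normed_vector set"
  assumes "finite F" and "subspace Y" and "closed Y" and "span (Y \<union> F) = UNIV"
  shows "\<exists>N (\<phi>::nat \<Rightarrow> 'a \<Rightarrow>\<^sub>L real) w. \<forall>x. x - (\<Sum>i<N. blinfun_apply (\<phi> i) x *\<^sub>R w i) \<in> Y"
  using assms
proof (induction F arbitrary: Y rule: finite_induct)
  case empty
  then have "Y = UNIV" using span_eq_iff[of Y] by simp
  then show ?case by simp
next
  case (insert v F)
  let ?Z = "span (insert v Y)"
  have "?Z \<union> F \<supseteq> Y \<union> insert v F" by (auto intro: span_base)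
  then have "span (?Z \<union> F) = UNIV" using insert.prems(3) span_mono by blast
  then obtain N and \<phi> :: "nat \<Rightarrow> 'a \<Rightarrow>\<^sub>L real" and w
    where N: "\<And>x. x - (\<Sum>i<N. blinfun_apply (\<phi> i) x *\<^sub>R w i) \<in> ?Z"
    using insert.IH[of ?Z] closed_span_insert[OF insert.prems(1,2)] by auto
  show ?case
  proof (cases "v \<in> Y")
    case True
    then have "?Z = Y" using insert.prems(1) by (simp add: insert_absorb span_eq_iff[THEN iffD2])
    with N show ?thesis by auto
  next
    case False
    define T where "T x = x - (\<Sum>i<N. blinfun_apply (\<phi> i) x *\<^sub>R w i)" for x
    have T: "bounded_linear T" unfolding T_def
      by (intro bounded_linear_intros bounded_linear_sub bounded_linear_sum
          bounded_linear_scaleR_const blinfun.bounded_linear_right)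
    obtain d where d: "d > 0" "\<And>x t. x - t *\<^sub>R v \<in> Y \<Longrightarrow> \<bar>t\<bar> * d \<le> norm x"
      using closed_subspace_dist_bound[OF insert.prems(1,2) False] by blast
    have "\<exists>t. T x - t *\<^sub>R v \<in> Y" for x
      using N[of x] insert.prems(1) by (simp add: T_def span_breakdown_eq span_eq_iff[THEN iffD2])
    then obtain g where g: "\<And>x. T x - g x *\<^sub>R v \<in> Y" by metis
    have guniq: "g x = t" if "T x - t *\<^sub>R v \<in> Y" for x t
    proof -
      have "0 - (t - g x) *\<^sub>R v \<in> Y"
        using subspace_diff[OF insert.prems(1) that g[of x]] by (simp add: algebra_simps)
      then have "\<bar>t - g x\<bar> * d \<le> norm (0::'a)" by (rule d(2))
      then show ?thesis using d(1) by (simp add: mult_le_0_iff)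
    qed
    obtain K where K: "\<And>x. norm (T x) \<le> norm x * K" using bounded_linear.bounded[OF T] by blast
    have "bounded_linear g"
    proof (rule bounded_linear_intro[where K = "K / d"])
      fix x y
      show "g (x + y) = g x + g y"
        using subspace_add[OF insert.prems(1) g[of x] g[of y]]
        by (intro guniq) (simp add: linear_simps[OF T] algebra_simps)
    next
      fix r x
      show "g (r *\<^sub>R x) = r *\<^sub>R g x"
        using subspace_scale[OF insert.prems(1) g[of x], of r]
        by (intro guniq) (simp add: linear_simps[OF T] algebra_simps)
    next
      fix x
      have "\<bar>g x\<bar> * d \<le> norm x * K" using d(2)[OF g[of x]] K[of x] by simp
      then show "norm (g x) \<le> norm x * (K / d)" using d(1) by (simp add: field_simps)
    qed
    then have "x - (\<Sum>i<Suc N. blinfun_apply ((\<phi>(N := Blinfun g)) i) x *\<^sub>R (w(N := v)) i) \<in> Y" for x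
      using g[of x] by (simp add: T_def bounded_linear_Blinfun_apply diff_diff_eq)
    then show ?thesis by blast
  qed
qed

lemma closed_fin_codim_functionals:
  fixes Y :: "'a::real_normed_vector set"
  assumes "closed_fin_codim Y"
  shows "\<exists>N (\<phi>::nat \<Rightarrow> 'a \<Rightarrow>\<^sub>L real) w. \<forall>x. x - (\<Sum>i<N. blinfun_apply (\<phi> i) x *\<^sub>R w i) \<in> Y"
  using assms fin_codim_functionals unfolding closed_fin_codim_def by blast

text \<open>The finite-rank correction into \<open>Y\<close> has finitely many coefficients, each
  tending to 0 along a weakly null family, so it tends to 0 in norm.\<close>

lemma weakly_null_near_fin_codim:
  fixes Y :: "'a::real_normed_vector set"
  assumes Y: "closed_fin_codim Y" and u: "weak_lim U u 0" and \<delta>: "\<delta> > 0"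
  shows "eventually (\<lambda>n. \<exists>z\<in>Y. norm (u n - z) \<le> \<delta>) U"
proof -
  obtain N and \<phi> :: "nat \<Rightarrow> 'a \<Rightarrow>\<^sub>L real" and w
    where N: "\<And>x. x - (\<Sum>i<N. blinfun_apply (\<phi> i) x *\<^sub>R w i) \<in> Y"
    using closed_fin_codim_functionals[OF Y] by blast
  have "((\<lambda>n. blinfun_apply (\<phi> i) (u n)) \<longlongrightarrow> 0) U" for i
    using u unfolding weak_lim_def by (metis blinfun.zero_right)
  then have "((\<lambda>n. \<Sum>i<N. blinfun_apply (\<phi> i) (u n) *\<^sub>R w i) \<longlongrightarrow> (\<Sum>i<N. 0 *\<^sub>R w i)) U"
    by (intro tendsto_intros)
  then have "((\<lambda>n. \<Sum>i<N. blinfun_apply (\<phi> i) (u n) *\<^sub>R w i) \<longlongrightarrow> 0) U" by simp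
  then have "eventually (\<lambda>n. norm (\<Sum>i<N. blinfun_apply (\<phi> i) (u n) *\<^sub>R w i) < \<delta>) U"
    using \<delta> by (simp add: tendsto_iff)
  then show ?thesis
    by eventually_elim (metis N less_imp_le diff_add_cancel add_diff_cancel_left')
qed

text \<open>If \<open>\<phi>\<close> does not vanish on \<open>K\<close>, one \<open>v\<close> in
  \<open>K\<close> with \<open>\<phi> v \<noteq> 0\<close> spans \<open>K\<close> modulo the kernel,
  so adding it to \<open>F\<close> suffices.\<close>

lemma fin_codim_Int_kernel:
  fixes K :: "'a::real_vector set" and \<phi> :: "'a \<Rightarrow> real"
  assumes K: "subspace K" and F: "finite F" "span (K \<union> F) = UNIV" and lin: "linear \<phi>"
  shows "\<exists>F'. finite F' \<and> span ((K \<inter> {x. \<phi> x = 0}) \<union> F') = UNIV"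
proof (cases "\<exists>v\<in>K. \<phi> v \<noteq> 0")
  case True
  then obtain v where v: "v \<in> K" "\<phi> v \<noteq> 0" by blast
  let ?S = "(K \<inter> {x. \<phi> x = 0}) \<union> insert v F"
  have "K \<subseteq> span ?S"
  proof
    fix x assume x: "x \<in> K"
    have "x - (\<phi> x / \<phi> v) *\<^sub>R v \<in> K \<inter> {x. \<phi> x = 0}"
      using x v K lin by (simp add: subspace_diff subspace_scale linear_diff linear_scale)
    then have "(x - (\<phi> x / \<phi> v) *\<^sub>R v) + (\<phi> x / \<phi> v) *\<^sub>R v \<in> span ?S"
      by (intro span_add span_scale) (auto intro: span_base)
    then show "x \<in> span ?S" by simp
  qed
  moreover have "F \<subseteq> span ?S" by (auto intro: span_base)
  ultimately have "span (K \<union> F) \<subseteq> span ?S" by (intro span_minimal) auto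
  then show ?thesis using F by (intro exI[of _ "insert v F"]) auto
next
  case False
  then have "K \<inter> {x. \<phi> x = 0} = K" by auto
  then show ?thesis using F by auto
qed

lemma closed_fin_codim_UNIV: "closed_fin_codim UNIV"
  by (auto simp: closed_fin_codim_def intro!: exI[of _ "{}"])

lemma closed_fin_codim_kernel:
  "closed_fin_codim {x. blinfun_apply \<phi> x = (0::real)}"
proof -
  have lin: "linear (blinfun_apply \<phi>)"
    by (rule bounded_linear.linear[OF blinfun.bounded_linear_right])
  have "closed {x. blinfun_apply \<phi> x = 0}"
    by (intro closed_Collect_eq continuous_intros)
  moreover have "subspace {x. blinfun_apply \<phi> x = 0}"
    by (auto simp: subspace_def blinfun.bilinear_simps)
  ultimately show ?thesis
    using fin_codim_Int_kernel[OF subspace_UNIV, of "{}" "blinfun_apply \<phi>"] lin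
    by (auto simp: closed_fin_codim_def)
qed

text \<open>The finite-rank correction for \<open>Z\<close> vanishes on the common kernel of its
  functionals, so this kernel lies in \<open>Z\<close>. Intersecting \<open>Y\<close> with these
  kernels one at a time keeps the codimension finite, and \<open>Y \<inter> Z\<close> is larger
  still.\<close>

lemma closed_fin_codim_Int:
  fixes Y Z :: "'a::real_normed_vector set"
  assumes Y: "closed_fin_codim Y" and Z: "closed_fin_codim Z"
  shows "closed_fin_codim (Y \<inter> Z)"
proof -
  obtain N and \<phi> :: "nat \<Rightarrow> 'a \<Rightarrow>\<^sub>L real" and w
    where N: "\<And>x. x - (\<Sum>i<N. blinfun_apply (\<phi> i) x *\<^sub>R w i) \<in> Z"
    using closed_fin_codim_functionals[OF Z] by blast
  define K where "K n = Y \<inter> {x. \<forall>i<n. blinfun_apply (\<phi> i) x = 0}" for n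
  have "subspace (K n) \<and> (\<exists>F. finite F \<and> span (K n \<union> F) = UNIV)" for n
  proof (induction n)
    case 0
    then show ?case using Y by (simp add: K_def closed_fin_codim_def)
  next
    case (Suc n)
    have eq: "K (Suc n) = K n \<inter> {x. blinfun_apply (\<phi> n) x = 0}"
      by (auto simp: K_def less_Suc_eq)
    have "subspace {x. blinfun_apply (\<phi> n) x = 0}"
      by (auto simp: subspace_def blinfun.bilinear_simps)
    then show ?case
      using Suc fin_codim_Int_kernel[of "K n" _ "blinfun_apply (\<phi> n)"]
        bounded_linear.linear[OF blinfun.bounded_linear_right[of "\<phi> n"]]
      unfolding eq by (blast intro: subspace_inter)
  qed
  then obtain F where F: "finite F" "span (K N \<union> F) = UNIV" by blast
  have "K N \<subseteq> Y \<inter> Z"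
  proof
    fix x assume x: "x \<in> K N"
    then have "(\<Sum>i<N. blinfun_apply (\<phi> i) x *\<^sub>R w i) = 0" by (simp add: K_def)
    with N[of x] x show "x \<in> Y \<inter> Z" by (simp add: K_def)
  qed
  then have "span (K N \<union> F) \<subseteq> span ((Y \<inter> Z) \<union> F)" by (intro span_mono) auto
  with F Y Z show ?thesis
    unfolding closed_fin_codim_def by (auto intro: subspace_inter)
qed

subsection \<open>The filter of the asymptotic game\<close>

text \<open>A property of outcomes holds eventually along this filter iff the player choosing the
  subspaces can enforce it; the subspaces of two strategies can be intersected.\<close>
definition game_filter :: "nat \<Rightarrow> 'a::real_normed_vector list \<Rightarrow> 'a list filter" where
  "game_filter n xs = Abs_filter (\<lambda>Q. \<not> asym_game n (\<lambda>l. \<not> Q l) xs)"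

lemma asym_game_mono:
  "asym_game n P xs \<Longrightarrow> (\<And>l. P l \<Longrightarrow> Q l) \<Longrightarrow> asym_game n Q xs"
  by (induction n arbitrary: xs) (auto, blast)

lemma not_asym_game_False: "\<not> asym_game n (\<lambda>_. False) xs"
  by (induction n arbitrary: xs) (auto intro: closed_fin_codim_UNIV)

text \<open>A subspace spoiling \<open>P\<close> and one spoiling \<open>Q\<close> intersect in a
  subspace spoiling both. Read for negations, this closes the enforceable properties under
  conjunction.\<close>

lemma asym_game_disj:
  "asym_game n (\<lambda>l. P l \<or> Q l) xs \<Longrightarrow> asym_game n P xs \<or> asym_game n Q xs"
proof (induction n arbitrary: xs)
  case (Suc n)
  show ?case
  proof (rule ccontr)
    assume "\<not> ?case"
    then obtain Y Z where "closed_fin_codim Y" "closed_fin_codim Z"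
      and Y: "\<And>x. x \<in> Y \<Longrightarrow> norm x = 1 \<Longrightarrow> \<not> asym_game n P (xs @ [x])"
      and Z: "\<And>x. x \<in> Z \<Longrightarrow> norm x = 1 \<Longrightarrow> \<not> asym_game n Q (xs @ [x])" by auto
    then have "closed_fin_codim (Y \<inter> Z)" by (intro closed_fin_codim_Int)
    with Suc.prems obtain x where "x \<in> Y \<inter> Z" "norm x = 1" "asym_game n (\<lambda>l. P l \<or> Q l) (xs @ [x])"
      by auto
    then show False using Suc.IH Y Z by blast
  qed
qed simp

lemma eventually_game_filter:
  "eventually Q (game_filter n xs) \<longleftrightarrow> \<not> asym_game n (\<lambda>l. \<not> Q l) xs"
  unfolding game_filter_def
proof (rule eventually_Abs_filter, rule is_filter.intro)
  show "\<not> asym_game n (\<lambda>l. \<not> True) xs" by (simp add: not_asym_game_False)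
next
  fix P Q assume "\<not> asym_game n (\<lambda>l. \<not> P l) xs" "\<not> asym_game n (\<lambda>l. \<not> Q l) xs"
  then show "\<not> asym_game n (\<lambda>l. \<not> (P l \<and> Q l)) xs"
    using asym_game_disj[of n "\<lambda>l. \<not> P l" "\<lambda>l. \<not> Q l" xs] by auto
next
  fix P Q :: "'a list \<Rightarrow> bool"
  assume "\<forall>x. P x \<longrightarrow> Q x" "\<not> asym_game n (\<lambda>l. \<not> P l) xs"
  then show "\<not> asym_game n (\<lambda>l. \<not> Q l) xs"
    using asym_game_mono[of n "\<lambda>l. \<not> Q l" xs "\<lambda>l. \<not> P l"] by blast
qed

lemma frequently_game_filter: "frequently P (game_filter n xs) \<longleftrightarrow> asym_game n P xs"
  by (simp add: frequently_def eventually_game_filter)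

lemma eventually_game_filter_0: "eventually Q (game_filter 0 xs) \<longleftrightarrow> Q xs"
  by (simp add: eventually_game_filter)

lemma eventually_game_filter_Suc:
  "eventually Q (game_filter (Suc n) xs) \<longleftrightarrow>
    (\<exists>Y. closed_fin_codim Y \<and> (\<forall>x\<in>Y. norm x = 1 \<longrightarrow> eventually Q (game_filter n (xs @ [x]))))"
  by (auto simp: eventually_game_filter)

text \<open>The subspace player offers the same \<open>Y\<close> in every round.\<close>

lemma eventually_game_filter_moves:
  assumes Y: "closed_fin_codim Y"
  shows "eventually (\<lambda>l. \<exists>zs. l = xs @ zs \<and> length zs = n \<and> (\<forall>z\<in>set zs. z \<in> Y \<and> norm z = 1))
    (game_filter n xs)"
proof (induction n arbitrary: xs)
  case 0
  then show ?case by (simp add: eventually_game_filter_0)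
next
  case (Suc n)
  have "eventually (\<lambda>l. \<exists>zs. l = xs @ zs \<and> length zs = Suc n \<and> (\<forall>z\<in>set zs. z \<in> Y \<and> norm z = 1))
      (game_filter n (xs @ [x]))" if "x \<in> Y" "norm x = 1" for x
    using Suc.IH[of "xs @ [x]"]
  proof eventually_elim
    case (elim l)
    then obtain zs where "l = xs @ x # zs" "length zs = n" "\<forall>z\<in>set zs. z \<in> Y \<and> norm z = 1"
      by auto
    with that show ?case by (intro exI[of _ "x # zs"]) auto
  qed
  with Y show ?case unfolding eventually_game_filter_Suc by blast
qed

text \<open>The whole space is offered in the first \<open>p\<close> rounds; the strategy for the
  last \<open>n\<close> rounds may depend on the moves seen so far.\<close>

lemma eventually_game_filter_add:
  assumes "\<And>ys. length ys = p \<Longrightarrow> eventually Q (game_filter n (xs @ ys))"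
  shows "eventually Q (game_filter (p + n) xs)"
  using assms
proof (induction p arbitrary: xs)
  case 0
  then show ?case by simp
next
  case (Suc p)
  have "eventually Q (game_filter (p + n) (xs @ [x]))" for x
    by (rule Suc.IH) (use Suc.prems[of "x # _"] in simp)
  then show ?case using closed_fin_codim_UNIV by (auto simp: eventually_game_filter_Suc)
qed

section \<open>Normalized and monotone outcomes of the game\<close>

definition unit_list :: "nat \<Rightarrow> 'a::real_normed_vector list \<Rightarrow> bool" where
  "unit_list k l \<longleftrightarrow> length l = k \<and> (\<forall>y\<in>set l. norm y = 1)"

lemma eventually_unit_list: "eventually (unit_list k) (game_filter k [])"
  using eventually_game_filter_moves[OF closed_fin_codim_UNIV, of "[]" k]
  by (auto simp: unit_list_def elim: eventually_mono)

abbreviation truncate :: "nat \<Rightarrow> (nat \<Rightarrow> real) \<Rightarrow> nat \<Rightarrow> real" where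
  "truncate m a \<equiv> \<lambda>i. if i < m then a i else 0"

lemma seq_norm_truncate:
  assumes "m \<le> k"
  shows "seq_norm k l (truncate m a) = seq_norm m l a"
proof -
  have "(\<Sum>j<k. truncate m a j *\<^sub>R (l ! j)) = (\<Sum>j<m. a j *\<^sub>R (l ! j))"
    using assms by (intro sum.mono_neutral_cong_right) auto
  then show ?thesis by (simp add: seq_norm_def)
qed

text \<open>Once the first vectors are known, the subspace player keeps playing the kernel of a
  functional norming their linear combination.\<close>
lemma eventually_monotone:
  fixes a :: "nat \<Rightarrow> real"
  assumes "m \<le> k"
  shows "eventually (\<lambda>l::'a::real_normed_vector list. seq_norm m l a \<le> seq_norm k l a) (game_filter k [])"
proof -
  obtain n where k: "k = m + n" using assms le_Suc_ex by blast
  have "eventually (\<lambda>l. seq_norm m l a \<le> seq_norm k l a) (game_filter n ys)"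
    if ys: "length ys = m" for ys :: "'a list"
  proof -
    obtain \<phi> :: "'a \<Rightarrow>\<^sub>L real" where \<phi>: "blinfun_apply \<phi> (\<Sum>j<m. a j *\<^sub>R (ys ! j)) = seq_norm m ys a"
        "\<And>x. \<bar>blinfun_apply \<phi> x\<bar> \<le> norm x"
      using norming_functional_exists[of "\<Sum>j<m. a j *\<^sub>R (ys ! j)"] by (auto simp: seq_norm_def)
    show ?thesis
      using eventually_game_filter_moves[OF closed_fin_codim_kernel[of \<phi>], of ys n]
    proof eventually_elim
      case (elim l)
      then obtain zs where zs: "l = ys @ zs" "length zs = n"
          "\<And>z. z \<in> set zs \<Longrightarrow> blinfun_apply \<phi> z = 0"
        by auto
      have old: "l ! j = ys ! j" if "j < m" for j using that zs ys by (simp add: nth_append)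
      have new: "blinfun_apply \<phi> (l ! j) = 0" if "j < k" "\<not> j < m" for j
        using that zs ys k by (simp add: nth_append)
      have "blinfun_apply \<phi> (\<Sum>j<k. a j *\<^sub>R (l ! j)) = (\<Sum>j<k. a j * blinfun_apply \<phi> (l ! j))"
        by (simp add: blinfun.bilinear_simps blinfun.sum_right)
      also have "\<dots> = (\<Sum>j<m. a j * blinfun_apply \<phi> (ys ! j))"
        using assms by (intro sum.mono_neutral_cong_right) (auto simp: old new)
      also have "\<dots> = blinfun_apply \<phi> (\<Sum>j<m. a j *\<^sub>R (ys ! j))"
        by (simp add: blinfun.bilinear_simps blinfun.sum_right)
      also have "\<dots> = seq_norm m l a" unfolding \<phi>(1) by (simp add: seq_norm_def old)
      finally show ?case
        using \<phi>(2)[of "\<Sum>j<k. a j *\<^sub>R (l ! j)"] by (simp add: seq_norm_def)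
    qed
  qed
  then show ?thesis unfolding k by (intro eventually_game_filter_add) simp
qed

subsection \<open>Limit norms belong to the asymptotic structure\<close>

definition limit_norm :: "'a::real_normed_vector list filter \<Rightarrow> nat \<Rightarrow> (nat \<Rightarrow> real) \<Rightarrow> real" where
  "limit_norm U k a = Lim U (\<lambda>l. seq_norm k l a)"

lemma seq_norm_le_sum:
  assumes "unit_list k l"
  shows "seq_norm k l a \<le> (\<Sum>j<k. \<bar>a j\<bar>)"
proof -
  have "seq_norm k l a \<le> (\<Sum>j<k. norm (a j *\<^sub>R (l ! j)))"
    unfolding seq_norm_def by (rule norm_sum)
  also have "\<dots> = (\<Sum>j<k. \<bar>a j\<bar>)"
    using assms by (intro sum.cong) (auto simp: unit_list_def)
  finally show ?thesis .
qed

lemma seq_norm_diff_le: "\<bar>seq_norm k l a - seq_norm k l b\<bar> \<le> seq_norm k l (\<lambda>j. a j - b j)"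
  unfolding seq_norm_def scaleR_diff_left sum_subtractf by (rule norm_triangle_ineq3)

lemma seq_norm_scale: "seq_norm k l (\<lambda>j. c * a j) = \<bar>c\<bar> * seq_norm k l a"
  by (simp add: seq_norm_def scaleR_sum_right[symmetric] flip: scaleR_scaleR)

lemma seq_norm_add_le: "seq_norm k l (\<lambda>j. a j + b j) \<le> seq_norm k l a + seq_norm k l b"
  by (simp add: seq_norm_def scaleR_add_left sum.distrib norm_triangle_ineq)

text \<open>Everything the subspace player can enforce holds along \<open>U\<close>; conversely,
  nothing that holds along \<open>U\<close> can be prevented by the subspace player.\<close>

locale game_ultrafilter =
  fixes U :: "'a::real_normed_vector list filter" and k :: nat
  assumes ultra: "ultra U" and le_game: "U \<le> game_filter k []"
begin

lemma U_not_bot: "U \<noteq> bot"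
  using ultra by (simp add: ultra_def)

lemma eventually_U: "eventually P (game_filter k []) \<Longrightarrow> eventually P U"
  using le_game by (rule filter_leD)

lemma tendsto_limit_norm: "((\<lambda>l. seq_norm k l a) \<longlongrightarrow> limit_norm U k a) U"
  unfolding limit_norm_def
proof (rule ultra_Lim[OF ultra])
  show "eventually (\<lambda>l. \<bar>seq_norm k l a\<bar> \<le> (\<Sum>j<k. \<bar>a j\<bar>)) U"
    using eventually_U[OF eventually_unit_list]
    by eventually_elim (metis seq_norm_le_sum seq_norm_def abs_norm_cancel)
qed

text \<open>Continuity in the coefficients; it also shows that only the coefficients below
  \<open>k\<close> matter.\<close>

lemma limit_norm_diff_le: "\<bar>limit_norm U k a - limit_norm U k b\<bar> \<le> (\<Sum>j<k. \<bar>a j - b j\<bar>)"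
proof (rule tendsto_upperbound)
  show "((\<lambda>l. \<bar>seq_norm k l a - seq_norm k l b\<bar>) \<longlongrightarrow> \<bar>limit_norm U k a - limit_norm U k b\<bar>) U"
    by (intro tendsto_intros tendsto_limit_norm)
  show "eventually (\<lambda>l. \<bar>seq_norm k l a - seq_norm k l b\<bar> \<le> (\<Sum>j<k. \<bar>a j - b j\<bar>)) U"
    using eventually_U[OF eventually_unit_list]
    by eventually_elim (rule order_trans[OF seq_norm_diff_le seq_norm_le_sum])
qed (rule U_not_bot)

lemma limit_norm_scale: "limit_norm U k (\<lambda>j. c * a j) = \<bar>c\<bar> * limit_norm U k a"
proof (rule tendsto_unique[OF U_not_bot tendsto_limit_norm])
  show "((\<lambda>l. seq_norm k l (\<lambda>j. c * a j)) \<longlongrightarrow> \<bar>c\<bar> * limit_norm U k a) U"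
    unfolding seq_norm_scale by (intro tendsto_intros tendsto_limit_norm)
qed

lemma limit_norm_add_le: "limit_norm U k (\<lambda>j. a j + b j) \<le> limit_norm U k a + limit_norm U k b"
  by (rule tendsto_le[OF U_not_bot tendsto_add[OF tendsto_limit_norm tendsto_limit_norm] tendsto_limit_norm])
    (simp add: seq_norm_add_le)

lemma limit_norm_unit:
  assumes "i < k"
  shows "limit_norm U k (\<lambda>j. if j = i then 1 else 0) = 1"
proof (rule tendsto_unique[OF U_not_bot tendsto_limit_norm])
  show "((\<lambda>l. seq_norm k l (\<lambda>j. if j = i then 1 else 0)) \<longlongrightarrow> 1) U"
  proof (rule tendsto_eventually)
    show "eventually (\<lambda>l. seq_norm k l (\<lambda>j. if j = i then 1 else 0) = 1) U"
      using eventually_U[OF eventually_unit_list]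
    proof eventually_elim
      case (elim l)
      have "(\<Sum>j<k. (if j = i then 1 else 0) *\<^sub>R (l ! j)) = (\<Sum>j<k. if j = i then l ! j else 0)"
        by (intro sum.cong) auto
      also have "\<dots> = l ! i" using assms by simp
      finally show ?case using elim assms by (simp add: seq_norm_def unit_list_def)
    qed
  qed
qed

lemma limit_norm_truncate_le:
  assumes "m \<le> k"
  shows "limit_norm U k (truncate m a) \<le> limit_norm U k a"
proof (rule tendsto_le[OF U_not_bot tendsto_limit_norm tendsto_limit_norm])
  show "eventually (\<lambda>l. seq_norm k l (truncate m a) \<le> seq_norm k l a) U"
    unfolding seq_norm_truncate[OF assms] by (rule eventually_U[OF eventually_monotone[OF assms]])
qed

text \<open>A coordinate is the difference of two consecutive truncations, each of norm at most that
  of \<open>a\<close> by monotonicity; hence the factor 2.\<close>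

lemma coeff_le_limit_norm:
  assumes "j < k"
  shows "\<bar>a j\<bar> \<le> 2 * limit_norm U k a"
proof -
  have "\<bar>a j\<bar> = limit_norm U k (\<lambda>i. a j * (if i = j then 1 else 0))"
    unfolding limit_norm_scale limit_norm_unit[OF assms] by simp
  also have "(\<lambda>i. a j * (if i = j then 1 else 0)) = (\<lambda>i. truncate (Suc j) a i + (- 1) * truncate j a i)"
    by (auto simp: fun_eq_iff less_Suc_eq)
  also have "limit_norm U k \<dots> \<le> limit_norm U k (truncate (Suc j) a) + limit_norm U k (truncate j a)"
    using limit_norm_add_le[of "truncate (Suc j) a" "\<lambda>i. (- 1) * truncate j a i"]
    unfolding limit_norm_scale by simp
  also have "\<dots> \<le> limit_norm U k a + limit_norm U k a"
    using assms by (intro add_mono limit_norm_truncate_le) auto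
  finally show ?thesis by simp
qed

lemma normalized_monotone_limit_norm: "normalized_monotone_norm k (limit_norm U k)"
proof -
  have "limit_norm U k a = 0 \<longleftrightarrow> (\<forall>j. a j = 0)" if "supported k a" for a
  proof
    assume "limit_norm U k a = 0"
    then have "a j = 0" if "j < k" for j using coeff_le_limit_norm[OF that, of a] by simp
    with that show "\<forall>j. a j = 0" unfolding supported_def by (metis not_le)
  next
    assume "\<forall>j. a j = 0"
    then have "a = (\<lambda>j. 0 * a j)" by auto
    then show "limit_norm U k a = 0" using limit_norm_scale[of 0 a] by simp
  qed
  then show ?thesis
    unfolding normalized_monotone_norm_def norm_on_Rk_def
    using limit_norm_add_le limit_norm_scale limit_norm_unit limit_norm_truncate_le by blast
qed

text \<open>Bad coefficients, chosen depending on the outcome, converge along the ultrafilter as well.\<close>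
lemma limit_norm_uniform:
  assumes \<eta>: "\<eta> > 0"
  shows "eventually (\<lambda>l. \<forall>a. (\<forall>j<k. \<bar>a j\<bar> \<le> 2) \<longrightarrow> \<bar>seq_norm k l a - limit_norm U k a\<bar> \<le> \<eta>) U"
proof (rule ccontr)
  assume "\<not> ?thesis"
  then have bad: "eventually (\<lambda>l. \<exists>a. (\<forall>j<k. \<bar>a j\<bar> \<le> 2) \<and> \<bar>seq_norm k l a - limit_norm U k a\<bar> > \<eta>) U"
    using ultra by (fastforce simp: ultra_def not_le elim: eventually_mono)
  define a where "a l = (SOME a. (\<forall>j<k. \<bar>a j\<bar> \<le> 2) \<and> \<bar>seq_norm k l a - limit_norm U k a\<bar> > \<eta>)" for l :: "'a list"
  have a: "eventually (\<lambda>l. (\<forall>j<k. \<bar>a l j\<bar> \<le> 2) \<and> \<bar>seq_norm k l (a l) - limit_norm U k (a l)\<bar> > \<eta>) U"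
    using bad unfolding a_def by eventually_elim (drule someI_ex, assumption)
  define b where "b j = Lim U (\<lambda>l. a l j)" for j
  have lim: "((\<lambda>l. a l j) \<longlongrightarrow> b j) U" if "j < k" for j
    unfolding b_def by (rule ultra_Lim[OF ultra]) (use a that in \<open>auto elim: eventually_mono\<close>)
  \<comment> \<open>Passing from \<open>a l\<close> to the fixed limit \<open>b\<close> costs this
    sum twice, once in the outcome norm and once in the limit norm; at \<open>b\<close> itself the
    outcome norms converge.\<close>
  have "((\<lambda>l. \<Sum>j<k. \<bar>a l j - b j\<bar>) \<longlongrightarrow> (\<Sum>j<k. \<bar>b j - b j\<bar>)) U"
    by (intro tendsto_intros lim) auto
  from tendsto_add[OF tendsto_add[OF this this] tendsto_rabs[OF tendsto_diff[OF tendsto_limit_norm tendsto_const]]]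
  have "((\<lambda>l. (\<Sum>j<k. \<bar>a l j - b j\<bar>) + (\<Sum>j<k. \<bar>a l j - b j\<bar>) + \<bar>seq_norm k l b - limit_norm U k b\<bar>)
      \<longlongrightarrow> (\<Sum>j<k. \<bar>b j - b j\<bar>) + (\<Sum>j<k. \<bar>b j - b j\<bar>) + \<bar>limit_norm U k b - limit_norm U k b\<bar>) U" .
  then have "eventually (\<lambda>l. (\<Sum>j<k. \<bar>a l j - b j\<bar>) + (\<Sum>j<k. \<bar>a l j - b j\<bar>)
      + \<bar>seq_norm k l b - limit_norm U k b\<bar> < \<eta>) U"
    using \<eta> by (intro order_tendstoD(2)) simp_all
  with a eventually_U[OF eventually_unit_list] have "eventually (\<lambda>_. False) U"
  proof eventually_elim
    case (elim l)
    have "\<bar>seq_norm k l (a l) - seq_norm k l b\<bar> \<le> (\<Sum>j<k. \<bar>a l j - b j\<bar>)"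
      using seq_norm_diff_le[of k l "a l" b] seq_norm_le_sum[OF elim(2), of "\<lambda>j. a l j - b j"] by simp
    then show ?case using elim limit_norm_diff_le[of "a l" b] by linarith
  qed
  with U_not_bot show False by (simp add: trivial_limit_def)
qed

text \<open>Uniform closeness on bounded coefficients becomes
  \<open>(1 + \<epsilon>)\<close>-equivalence by homogeneity. It holds along \<open>U\<close>, so
  the vector player can achieve it in the game.\<close>

lemma limit_norm_in_asym_structure: "limit_norm U k \<in> asym_structure TYPE('a) k"
proof -
  have "asym_game k (\<lambda>l::'a list. C_equiv k (seq_norm k l) (limit_norm U k) (1 + \<epsilon>)) []"
    if \<epsilon>: "\<epsilon> > 0" for \<epsilon>
  proof -
    \<comment> \<open>The solution of
      \<open>(1 + \<eta>) / (1 - \<eta>) = 1 + \<epsilon>\<close>.\<close>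
    define \<eta> where "\<eta> = \<epsilon> / (2 + \<epsilon>)"
    have \<eta>: "\<eta> > 0" "\<eta> < 1" and \<eta>\<epsilon>: "(1 + \<eta>) * (1 / (1 - \<eta>)) = 1 + \<epsilon>"
      using \<epsilon> by (simp_all add: \<eta>_def field_simps)
    have "eventually (\<lambda>l. C_equiv k (seq_norm k l) (limit_norm U k) (1 + \<epsilon>)) U"
      using limit_norm_uniform[OF \<eta>(1)]
    proof eventually_elim
      case (elim l)
      have "\<bar>seq_norm k l a - limit_norm U k a\<bar> \<le> \<eta> * limit_norm U k a" for a
      proof (cases "\<forall>j<k. a j = 0")
        case True
        then have "seq_norm k l a = 0" by (simp add: seq_norm_def)
        moreover have "limit_norm U k a = limit_norm U k (\<lambda>j. 0 * a j)"
          using limit_norm_diff_le[of a "\<lambda>j. 0"] True by simp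
        ultimately show ?thesis unfolding limit_norm_scale by simp
      next
        case False
        \<comment> \<open>After division by the limit norm the coefficients lie in
          \<open>[-2, 2]\<close>, where the uniform estimate is available.\<close>
        define t where "t = limit_norm U k a"
        have t: "t > 0" using False coeff_le_limit_norm[of _ a] unfolding t_def by force
        have "\<bar>a j / t\<bar> \<le> 2" if "j < k" for j
          using coeff_le_limit_norm[OF that, of a] t by (simp add: t_def field_simps)
        then have "\<bar>seq_norm k l (\<lambda>j. (1 / t) * a j) - limit_norm U k (\<lambda>j. (1 / t) * a j)\<bar> \<le> \<eta>"
          using elim by simp
        then have "\<bar>(1 / t) * (seq_norm k l a - t)\<bar> \<le> \<eta>"
          unfolding seq_norm_scale limit_norm_scale using t by (simp add: t_def right_diff_distrib)
        then show ?thesis unfolding t_def[symmetric] using t by (simp add: abs_mult field_simps)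
      qed
      then have "seq_norm k l a / (1 + \<eta>) \<le> limit_norm U k a \<and> limit_norm U k a \<le> 1 / (1 - \<eta>) * seq_norm k l a"
        for a using \<eta> by (simp add: field_simps abs_le_iff)
      then show ?case unfolding C_equiv_def
        using \<eta> \<eta>\<epsilon> by (intro exI[of _ "1 + \<eta>"] exI[of _ "1 / (1 - \<eta>)"]) auto
    qed
    then have "frequently (\<lambda>l. C_equiv k (seq_norm k l) (limit_norm U k) (1 + \<epsilon>)) U"
      using U_not_bot by (rule eventually_frequently[rotated])
    then show ?thesis
      unfolding frequently_game_filter[symmetric] using le_game by (meson filter_leD frequently_def)
  qed
  then show ?thesis using normalized_monotone_limit_norm by (simp add: asym_structure_def)
qed

end

text \<open>If the bound could not be enforced, some ultrafilter finer than the game filter would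
  live on bad outcomes. Its limit norm lies in the asymptotic structure and is at most
  \<open>\<bar>c\<bar>\<close> on the unit cube; uniform convergence with error 1 then contradicts
  badness.\<close>

lemma asymptotic_c0_game_bound:
  assumes "asymptotic_c0 TYPE('a::real_normed_vector)"
  shows "\<exists>C\<ge>0. \<forall>k. eventually (\<lambda>l::'a list. \<forall>a. (\<forall>j<k. \<bar>a j\<bar> \<le> 1) \<longrightarrow> seq_norm k l a \<le> C) (game_filter k [])"
proof -
  obtain c where c: "\<And>k E. E \<in> asym_structure TYPE('a) k \<Longrightarrow> C_equiv k (linf_norm k) E c"
    using assms unfolding asymptotic_c0_def by blast
  define good where "good k l \<longleftrightarrow> (\<forall>a. (\<forall>j<k. \<bar>a j\<bar> \<le> 1) \<longrightarrow> seq_norm k l a \<le> \<bar>c\<bar> + 1)"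
    for k and l :: "'a list"
  have "eventually (good k) (game_filter k [])" for k
  proof (rule ccontr)
    assume "\<not> eventually (good k) (game_filter k [])"
    then have "inf (game_filter k []) (principal {l. \<not> good k l}) \<noteq> bot"
      by (simp add: trivial_limit_def eventually_inf_principal)
    then obtain U where "ultra U" and U: "U \<le> inf (game_filter k []) (principal {l. \<not> good k l})"
      using ultra_exists by blast
    then interpret game_ultrafilter U k by unfold_locales auto
    have bad: "eventually (\<lambda>l. \<not> good k l) U"
      using U by (rule filter_leD) (simp add: eventually_inf_principal)
    have k: "k > 0"
    proof (rule ccontr)
      assume "\<not> k > 0"
      with bad have "eventually (\<lambda>_. False) U" by (simp add: seq_norm_def good_def)
      with U_not_bot show False by (simp add: trivial_limit_def)
    qed
    obtain A B where AB: "A > 0" "B > 0" "A * B \<le> c"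
      and eq: "\<And>a. supported k a \<Longrightarrow> linf_norm k a / A \<le> limit_norm U k a \<and> limit_norm U k a \<le> B * linf_norm k a"
      using c[OF limit_norm_in_asym_structure] unfolding C_equiv_def by blast
    \<comment> \<open>The first unit vector has sup norm at least 1 and limit norm 1, which forces
      \<open>A \<ge> 1\<close> and so bounds \<open>B\<close> alone by \<open>c\<close>.\<close>
    have "linf_norm k (\<lambda>j. if j = 0 then 1 else 0) \<ge> \<bar>if (0::nat) = 0 then 1 else 0\<bar>"
      unfolding linf_norm_def by (rule Max_ge) (use k in auto)
    moreover have "supported k (\<lambda>j. if j = 0 then 1 else 0)" using k by (auto simp: supported_def)
    ultimately have "1 / A \<le> 1"
      using eq[of "\<lambda>j. if j = 0 then 1 else 0"] limit_norm_unit[OF k] AB(1)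
      by (smt (verit) divide_right_mono)
    then have "A \<ge> 1" using AB(1) by (simp add: field_simps)
    then have "1 * B \<le> A * B" using AB(2) by (intro mult_right_mono) auto
    then have "B \<le> c" using AB(3) by simp
    have lim: "limit_norm U k a \<le> \<bar>c\<bar>" if a: "\<forall>j<k. \<bar>a j\<bar> \<le> 1" for a
    proof -
      have "linf_norm k (truncate k a) \<le> 1" unfolding linf_norm_def using a by (subst Max_le_iff) auto
      moreover have "limit_norm U k a \<le> limit_norm U k (truncate k a)"
        using limit_norm_diff_le[of a "truncate k a"] by simp
      moreover have "supported k (truncate k a)" by (simp add: supported_def)
      ultimately have "limit_norm U k a \<le> B * 1"
        using eq[of "truncate k a"] AB(2) mult_left_mono[of "linf_norm k (truncate k a)" 1 B] by linarith
      with \<open>B \<le> c\<close> show ?thesis by simp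
    qed
    from bad limit_norm_uniform[of 1] have "eventually (\<lambda>_. False) U"
    proof (rule eventually_elim2)
      fix l assume "\<not> good k l"
        and uni: "\<forall>a. (\<forall>j<k. \<bar>a j\<bar> \<le> 2) \<longrightarrow> \<bar>seq_norm k l a - limit_norm U k a\<bar> \<le> 1"
      then obtain a where a: "\<forall>j<k. \<bar>a j\<bar> \<le> 1" "seq_norm k l a > \<bar>c\<bar> + 1" by (force simp: good_def)
      moreover have "\<forall>j<k. \<bar>a j\<bar> \<le> 2" using a(1) by force
      ultimately show False using lim[OF a(1)] uni by force
    qed simp
    with U_not_bot show False by (simp add: trivial_limit_def)
  qed
  then show ?thesis unfolding good_def by (intro exI[of _ "\<bar>c\<bar> + 1"]) auto
qed

subsection \<open>The game for sums of vectors in the unit ball\<close>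

text \<open>Winning positions of the subspace player with \<open>n\<close> rounds left. Unlike in
  \<open>asym_game\<close>, moves come from the whole unit ball and only their sum \<open>w\<close>
  is remembered.\<close>

primrec sum_win :: "real \<Rightarrow> nat \<Rightarrow> 'a::real_normed_vector \<Rightarrow> bool" where
  "sum_win C 0 w \<longleftrightarrow> norm w \<le> C"
| "sum_win C (Suc n) w \<longleftrightarrow>
    (\<exists>Y. closed_fin_codim Y \<and> (\<forall>z\<in>Y. norm z \<le> 1 \<longrightarrow> sum_win C n (w + z)))"

lemma unit_vector_exists:
  fixes Y :: "'a::real_normed_vector set"
  assumes "subspace Y" and "z \<in> Y" and "z \<noteq> 0"
  shows "(1 / norm z) *\<^sub>R z \<in> Y" and "norm ((1 / norm z) *\<^sub>R z) = 1"
  using assms by (simp_all add: subspace_scale)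

text \<open>A move \<open>z\<close> from the ball is a unit vector times \<open>norm z\<close>, and
  \<open>norm z\<close> is recorded as a coefficient. The enforced bound covers all coefficients in
  \<open>[-1, 1]\<close>, so they may be chosen during play. For \<open>z = 0\<close> any unit
  vector of \<open>Y\<close> serves, whence the assumption \<open>unit\<close>.\<close>

lemma sum_win_of_game:
  fixes xs :: "'a::real_normed_vector list"
  assumes unit: "\<And>Y::'a set. closed_fin_codim Y \<Longrightarrow> \<exists>y\<in>Y. norm y = 1"
    and "eventually (\<lambda>l. \<forall>a. (\<forall>j<k. \<bar>a j\<bar> \<le> 1) \<longrightarrow> seq_norm k l a \<le> C) (game_filter n xs)"
    and "length xs + n = k" and "\<And>j. j < length xs \<Longrightarrow> \<bar>a j\<bar> \<le> 1"
  shows "sum_win C n (\<Sum>j<length xs. a j *\<^sub>R (xs ! j))"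
  using assms(2-)
proof (induction n arbitrary: xs a)
  case 0
  then show ?case by (auto simp: eventually_game_filter_0 seq_norm_def)
next
  case (Suc n)
  then obtain Y where Y: "closed_fin_codim Y"
    and ev: "\<And>y. y \<in> Y \<Longrightarrow> norm y = 1 \<Longrightarrow> eventually (\<lambda>l. \<forall>a. (\<forall>j<k. \<bar>a j\<bar> \<le> 1) \<longrightarrow> seq_norm k l a \<le> C)
      (game_filter n (xs @ [y]))"
    unfolding eventually_game_filter_Suc by blast
  have "sum_win C n ((\<Sum>j<length xs. a j *\<^sub>R (xs ! j)) + z)" if z: "z \<in> Y" "norm z \<le> 1" for z
  proof -
    have "\<exists>y\<in>Y. norm y = 1 \<and> z = norm z *\<^sub>R y"
    proof (cases "z = 0")
      case True
      then show ?thesis using unit[OF Y] by auto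
    next
      case False
      with Y z unit_vector_exists[of Y z] show ?thesis
        by (intro bexI[of _ "(1 / norm z) *\<^sub>R z"]) (auto simp: closed_fin_codim_def)
    qed
    then obtain y where y: "y \<in> Y" "norm y = 1" "z = norm z *\<^sub>R y" by blast
    define b where "b = a(length xs := norm z)"
    have "sum_win C n (\<Sum>j<length (xs @ [y]). b j *\<^sub>R ((xs @ [y]) ! j))"
    proof (rule Suc.IH[OF ev[OF y(1,2)]])
      show "\<bar>b j\<bar> \<le> 1" if "j < length (xs @ [y])" for j
        using that Suc.prems(3) z(2) by (auto simp: b_def less_Suc_eq)
    qed (use Suc.prems(2) in simp)
    also have "(\<Sum>j<length (xs @ [y]). b j *\<^sub>R ((xs @ [y]) ! j)) = (\<Sum>j<length xs. a j *\<^sub>R (xs ! j)) + z"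
      using y(3) by (simp add: b_def nth_append)
    finally show ?thesis .
  qed
  with Y show ?case by auto
qed

lemma asymptotic_c0_sum_win:
  assumes "asymptotic_c0 TYPE('a::real_normed_vector)"
  shows "\<exists>C\<ge>0. \<forall>k. sum_win C k (0::'a)"
proof -
  obtain C where C: "C \<ge> 0" and good: "\<And>k. eventually
      (\<lambda>l::'a list. \<forall>a. (\<forall>j<k. \<bar>a j\<bar> \<le> 1) \<longrightarrow> seq_norm k l a \<le> C) (game_filter k [])"
    using asymptotic_c0_game_bound[OF assms] by blast
  have "sum_win C k (0::'a)" for k
  proof (cases "\<forall>Y::'a set. closed_fin_codim Y \<longrightarrow> (\<exists>y\<in>Y. norm y = 1)")
    case True
    then show ?thesis using sum_win_of_game[OF _ good, of k "\<lambda>_. 0"] by simp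
  next
    case False
    then obtain Y :: "'a set" where Y: "closed_fin_codim Y" "\<And>y. y \<in> Y \<Longrightarrow> norm y \<noteq> 1" by blast
    \<comment> \<open>Degenerate case of a finite-dimensional space: offering the trivial subspace
      in every round keeps the sum fixed.\<close>
    then have "Y \<subseteq> {0}" using unit_vector_exists[of Y] unfolding closed_fin_codim_def by blast
    then have "sum_win C n w" if "norm w \<le> C" for n and w :: 'a
      using that by (induction n) (use Y(1) in \<open>auto intro!: exI[of _ Y]\<close>)
    with C show ?thesis by simp
  qed
  with C show ?thesis by blast
qed

subsection \<open>Iterated weak limits\<close>

text \<open>Iterated weak limit over the last \<open>n\<close> indices, with the last index
  innermost. The choice is meaningful when \<open>h\<close> is bounded and the space
  reflexive.\<close>

primrec tail_lim :: "nat filter \<Rightarrow> nat \<Rightarrow> (nat list \<Rightarrow> 'a::real_normed_vector) \<Rightarrow> nat list \<Rightarrow> 'a" where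
  "tail_lim U 0 h ms = h ms"
| "tail_lim U (Suc n) h ms = (SOME x. weak_lim U (\<lambda>m. tail_lim U n h (ms @ [m])) x)"

locale bounded_tree =
  fixes U :: "nat filter" and h :: "nat list \<Rightarrow> 'a::real_normed_vector" and K :: real
  assumes refl: "reflexive_space TYPE('a)"
    and ultra: "ultra U" and U_le: "U \<le> sequentially"
    and bdd: "\<And>ms. norm (h ms) \<le> K"
begin

lemma U_not_bot: "U \<noteq> bot"
  using ultra by (simp add: ultra_def)

lemma weak_lim_SOME:
  assumes "\<And>n. norm (u n) \<le> K"
  shows "weak_lim U u (SOME x::'a. weak_lim U u x)"
  using weak_lim_exists[OF refl ultra assms] by (rule someI_ex)

lemma norm_tail_lim_le: "norm (tail_lim U n h ms) \<le> K"
proof (induction n arbitrary: ms)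
  case (Suc n)
  show ?case
    using weak_lim_norm_le[OF weak_lim_SOME[OF Suc.IH] U_not_bot] Suc.IH by simp
qed (simp add: bdd)

lemma weak_lim_tail_lim: "weak_lim U (\<lambda>m. tail_lim U n h (ms @ [m])) (tail_lim U (Suc n) h ms)"
  using weak_lim_SOME[OF norm_tail_lim_le] by simp

lemma eventually_U_gt: "eventually (\<lambda>m. \<forall>q\<in>set ms. m > q \<and> m > N) U"
proof -
  have "eventually (\<lambda>m. m > Max (insert N (set ms))) U"
    using U_le eventually_gt_at_top by (rule filter_leD)
  then show ?thesis by eventually_elim simp
qed

end

section \<open>Trees that are Lipschitz in each index\<close>

locale lipschitz_tree = bounded_tree +
  fixes k :: nat and L :: real
  assumes L: "L > 0"
    and lip: "\<And>ms m m' rest. sorted_wrt (<) (ms @ m # rest) \<Longrightarrow> sorted_wrt (<) (ms @ m' # rest) \<Longrightarrow>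
      length (ms @ m # rest) = k \<Longrightarrow> norm (h (ms @ m # rest) - h (ms @ m' # rest)) \<le> L"
begin

text \<open>The Lipschitz bound survives weak limits by lower semicontinuity; along \<open>U\<close>
  the new index exceeds all entries of both lists, so both stay increasing.\<close>

lemma tail_lim_lip:
  assumes "sorted_wrt (<) (ms @ m # rest)" and "sorted_wrt (<) (ms @ m' # rest)"
    and "length (ms @ m # rest) + n = k"
  shows "norm (tail_lim U n h (ms @ m # rest) - tail_lim U n h (ms @ m' # rest)) \<le> L"
  using assms
proof (induction n arbitrary: rest)
  case 0
  then show ?case using lip by simp
next
  case (Suc n)
  show ?case
  proof (rule weak_lim_norm_le[OF weak_lim_diff[OF weak_lim_tail_lim weak_lim_tail_lim] U_not_bot])
    show "eventually (\<lambda>p. norm (tail_lim U n h ((ms @ m # rest) @ [p]) - tail_lim U n h ((ms @ m' # rest) @ [p])) \<le> L) U"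
      using eventually_U_gt[of "ms @ m # m' # rest" 0]
    proof eventually_elim
      case (elim p)
      then show ?case using Suc.IH[of "rest @ [p]"] Suc.prems by (auto simp: sorted_wrt_append)
    qed
  qed
qed

text \<open>The subtracted limit runs over lists \<open>ms @ [p]\<close>, each differing from
  \<open>ms @ [m]\<close> in at most one entry.\<close>

lemma tail_lim_step:
  assumes "sorted_wrt (<) (ms @ [m])" and "length ms + Suc n = k"
  shows "norm (tail_lim U n h (ms @ [m]) - tail_lim U (Suc n) h ms) \<le> L"
proof (rule weak_lim_norm_le[OF weak_lim_diff[OF weak_lim_const weak_lim_tail_lim] U_not_bot])
  show "eventually (\<lambda>p. norm (tail_lim U n h (ms @ [m]) - tail_lim U n h (ms @ [p])) \<le> L) U"
    using eventually_U_gt[of ms 0]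
  proof eventually_elim
    case (elim p)
    then show ?case using assms tail_lim_lip[of ms m "[]" p n] by (simp add: sorted_wrt_append)
  qed
qed

text \<open>The increments are weakly null in their last index, hence almost legal moves in the game
  for sums; \<open>2 * L\<close> leaves room for the perturbation \<open>\<delta>\<close>.\<close>
lemma branch_exists:
  assumes "\<delta> > 0" and "\<delta> \<le> L"
    and "sum_win C n w" and "sorted_wrt (<) ms" and "length ms + n = k"
  shows "\<exists>ns. length ns = n \<and> sorted_wrt (<) (ms @ ns) \<and> (\<forall>q\<in>set ns. q > N) \<and>
    norm (h (ms @ ns) - (tail_lim U n h ms - (2 * L) *\<^sub>R w)) \<le> 2 * L * C + n * \<delta>"
  using assms(3-)
proof (induction n arbitrary: ms w)
  case 0
  \<comment> \<open>With no index left the tail limit is \<open>h ms\<close> itself, so exactly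
    \<open>(2 * L) *\<^sub>R w\<close> remains.\<close>
  then have "norm ((2 * L) *\<^sub>R w) \<le> 2 * L * C" using L by simp
  then show ?case using 0 by simp
next
  case (Suc n)
  then obtain Y where Y: "closed_fin_codim Y"
    and win: "\<And>z. z \<in> Y \<Longrightarrow> norm z \<le> 1 \<Longrightarrow> sum_win C n (w + z)" by auto
  let ?x = "\<lambda>m. tail_lim U n h (ms @ [m]) - tail_lim U (Suc n) h ms"
  have "weak_lim U ?x 0"
    using weak_lim_diff[OF weak_lim_tail_lim weak_lim_const] by (metis diff_self)
  then have "eventually (\<lambda>m. \<exists>z\<in>Y. norm (?x m - z) \<le> \<delta>) U"
    by (rule weakly_null_near_fin_codim[OF Y _ assms(1)])
  \<comment> \<open>\<open>N\<close> is put into the list because the quantified bound says nothing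
    about an empty list.\<close>
  with eventually_U_gt[of "N # ms" N]
  have "eventually (\<lambda>m. (\<forall>q\<in>set (N # ms). m > q \<and> m > N) \<and> (\<exists>z\<in>Y. norm (?x m - z) \<le> \<delta>)) U"
    by eventually_elim blast
  then obtain m z where m: "\<And>q. q \<in> set (N # ms) \<Longrightarrow> m > q" and z: "z \<in> Y" "norm (?x m - z) \<le> \<delta>"
    using eventually_happens'[OF U_not_bot] by blast
  have sorted: "sorted_wrt (<) (ms @ [m])" using Suc.prems(2) m by (simp add: sorted_wrt_append)
  have "norm (?x m) \<le> L" using tail_lim_step[OF sorted Suc.prems(3)] .
  then have "norm z \<le> 2 * L"
    using z(2) assms(2) norm_triangle_sub[of z "?x m"] by (simp add: norm_minus_commute)
  then have "sum_win C n (w + (1 / (2 * L)) *\<^sub>R z)"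
    using Y z(1) L by (intro win) (auto simp: closed_fin_codim_def subspace_scale)
  then obtain ns where ns: "length ns = n" "sorted_wrt (<) ((ms @ [m]) @ ns)" "\<forall>q\<in>set ns. q > N"
    and le: "norm (h ((ms @ [m]) @ ns) - (tail_lim U n h (ms @ [m]) - (2 * L) *\<^sub>R (w + (1 / (2 * L)) *\<^sub>R z)))
      \<le> 2 * L * C + n * \<delta>"
    using Suc.IH[OF _ sorted] Suc.prems(3) by auto
  have "(2 * L) *\<^sub>R (w + (1 / (2 * L)) *\<^sub>R z) = (2 * L) *\<^sub>R w + z"
    using L by (simp add: scaleR_add_right)
  \<comment> \<open>Replacing the increment \<open>?x m\<close> by the move \<open>z\<close> is the
    only new error of this round.\<close>
  then have "h ((ms @ [m]) @ ns) - (tail_lim U (Suc n) h ms - (2 * L) *\<^sub>R w) =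
    (h ((ms @ [m]) @ ns) - (tail_lim U n h (ms @ [m]) - (2 * L) *\<^sub>R (w + (1 / (2 * L)) *\<^sub>R z))) + (?x m - z)"
    by (simp add: algebra_simps del: tail_lim.simps)
  then have "norm (h ((ms @ [m]) @ ns) - (tail_lim U (Suc n) h ms - (2 * L) *\<^sub>R w)) \<le> (2 * L * C + n * \<delta>) + \<delta>"
    using norm_triangle_mono[OF le z(2)] by metis
  with ns m show ?case
    by (intro exI[of _ "m # ns"]) (auto simp: algebra_simps simp del: tail_lim.simps)
qed

text \<open>Two branches, the second starting beyond the first, both stay near the same vector
  \<open>tail_lim U k h []\<close>.\<close>

lemma separated_branches_exist:
  assumes "sum_win C k (0::'a)"
  shows "\<exists>ms ns. length ms = k \<and> length ns = k \<and> sorted_wrt (<) ms \<and> sorted_wrt (<) ns \<and>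
    (\<forall>p\<in>set ms. \<forall>q\<in>set ns. p < q) \<and> norm (h ms - h ns) \<le> 2 * L * (2 * C + 1)"
proof -
  \<comment> \<open>Small enough that the errors of all \<open>k\<close> rounds add up to at most
    \<open>L\<close>.\<close>
  define \<delta> where "\<delta> = L / (k + 1)"
  have \<delta>: "\<delta> > 0" "\<delta> \<le> L" "k * \<delta> \<le> L" using L by (simp_all add: \<delta>_def field_simps)
  have "\<exists>ns. length ns = k \<and> sorted_wrt (<) ns \<and> (\<forall>q\<in>set ns. q > N) \<and>
      norm (h ns - tail_lim U k h []) \<le> 2 * L * C + L" for N
    using branch_exists[OF \<delta>(1,2) assms, of "[]" N] \<delta>(3) by force
  then obtain br where br: "\<And>N. length (br N) = k" "\<And>N. sorted_wrt (<) (br N)" "\<And>N q. q \<in> set (br N) \<Longrightarrow> q > N"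
      "\<And>N. norm (h (br N) - tail_lim U k h []) \<le> 2 * L * C + L"
    by metis
  define ms where "ms = br 0"
  define ns where "ns = br (Max (insert 0 (set ms)))"
  have "\<forall>p\<in>set ms. \<forall>q\<in>set ns. p < q"
    using br(3) unfolding ns_def by (meson List.finite_set Max_ge finite_insert insertCI le_less_trans)
  moreover have "norm (h ms - h ns) \<le> (2 * L * C + L) + (2 * L * C + L)"
    unfolding ms_def ns_def using br(4) by (rule norm_diff_triangle_le) (metis br(4) norm_minus_commute)
  ultimately show ?thesis
    using br by (intro exI[of _ ms] exI[of _ ns]) (auto simp: ms_def ns_def algebra_simps)
qed

end

subsection \<open>The metrics\<close>

lemma d_e_le:
  assumes "suppression_unconditional1 e"
  shows "d_e e k A B \<le> norm (\<Sum>j<k. e j)"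
proof -
  let ?F = "{j. j < k \<and> sorted_list_of_set A ! j \<noteq> sorted_list_of_set B ! j}"
  have "norm (\<Sum>j\<in>?F \<inter> {..<k}. (1::real) *\<^sub>R e j) \<le> norm (\<Sum>j<k. (1::real) *\<^sub>R e j)"
    using assms[unfolded suppression_unconditional1_def, rule_format, of "\<lambda>_. 1" "?F" k] by simp
  moreover have "?F \<inter> {..<k} = ?F" by auto
  ultimately show ?thesis by (simp add: d_e_def)
qed

text \<open>Suppression unconditionality bounds every distance, hence the diameter for
  \<open>UNIV\<close>. Real \<open>Sup\<close> and \<open>Inf\<close> need attained values and
  bounds; the distance of a set to itself supplies the lower bound 0.\<close>

lemma Inf_diam_k_le:
  assumes "suppression_unconditional1 e"
  shows "Inf {diam_k e k M | M. infinite M} \<le> norm (\<Sum>j<k. e j)"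
proof -
  have diam: "0 \<le> diam_k e k M \<and> diam_k e k M \<le> norm (\<Sum>j<k. e j)" if M: "infinite M" for M
  proof -
    obtain A where A: "A \<in> ksubsets M k"
      using infinite_arbitrarily_large[OF M, of k] by (auto simp: ksubsets_def)
    let ?S = "{d_e e k A B | A B. A \<in> ksubsets M k \<and> B \<in> ksubsets M k}"
    have bound: "x \<le> norm (\<Sum>j<k. e j)" if "x \<in> ?S" for x
      using that d_e_le[OF assms] by blast
    have mem: "d_e e k A A \<in> ?S" using A by blast
    have "bdd_above ?S" by (rule bdd_aboveI) (rule bound)
    then have "d_e e k A A \<le> Sup ?S" by (rule cSup_upper[OF mem])
    then have "0 \<le> Sup ?S" by (simp add: d_e_def)
    moreover have "Sup ?S \<le> norm (\<Sum>j<k. e j)"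
      using mem by (intro cSup_least bound) auto
    ultimately show ?thesis by (simp add: diam_k_def)
  qed
  have "bdd_below {diam_k e k M | M. infinite M}"
    by (rule bdd_belowI[of _ 0]) (use diam in blast)
  then have "Inf {diam_k e k M | M. infinite M} \<le> diam_k e k UNIV"
    by (intro cInf_lower) (use infinite_UNIV_nat in blast)
  also have "\<dots> \<le> norm (\<Sum>j<k. e j)" using diam[OF infinite_UNIV_nat] by blast
  finally show ?thesis .
qed

section \<open>Increasing lists as points of the metric space\<close>

lemma sorted_list_of_set_strict_sorted:
  "sorted_wrt (<) (ms :: nat list) \<Longrightarrow> sorted_list_of_set (set ms) = ms"
  by (simp add: sorted_list_of_set.idem_if_sorted_distinct strict_sorted_iff)

lemma strict_sorted_ksubset:
  "sorted_wrt (<) (ms :: nat list) \<Longrightarrow> length ms = k \<Longrightarrow> set ms \<in> ksubsets UNIV k"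
  by (simp add: ksubsets_def strict_sorted_iff distinct_card)

text \<open>Only position \<open>length ms\<close> can differ, so the distance is the norm of at
  most one basis vector.\<close>

lemma d_e_single_change:
  assumes "normalized_seq e"
    and "sorted_wrt (<) (ms @ m # rest)" and "sorted_wrt (<) (ms @ m' # rest)"
  shows "d_e e k (set (ms @ m # rest)) (set (ms @ m' # rest)) \<le> 1"
proof -
  define F where "F = {j. j < k \<and> (ms @ m # rest) ! j \<noteq> (ms @ m' # rest) ! j}"
  have "F \<subseteq> {length ms}" by (auto simp: F_def nth_append nth_Cons' split: if_splits)
  then have "F = {} \<or> F = {length ms}" by blast
  then have "norm (\<Sum>j\<in>F. e j) \<le> 1" using assms(1) by (auto simp: normalized_seq_def)
  then show ?thesis unfolding d_e_def assms(2,3)[THEN sorted_list_of_set_strict_sorted] F_def .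
qed

lemma d_e_separated:
  assumes "sorted_wrt (<) ms" and "sorted_wrt (<) ns" and "length ms = k" and "length ns = k"
    and "\<forall>p\<in>set ms. \<forall>q\<in>set ns. p < q"
  shows "d_e e k (set ms) (set ns) = norm (\<Sum>j<k. e j)"
proof -
  have "ms ! j < ns ! j" if "j < k" for j
    using assms(3-) that by (metis nth_mem)
  then have "{j. j < k \<and> ms ! j \<noteq> ns ! j} = {..<k}" by (auto dest: less_imp_neq)
  then show ?thesis unfolding d_e_def assms(1,2)[THEN sorted_list_of_set_strict_sorted] by simp
qed

text \<open>The embedding, read on increasing lists, is a Lipschitz tree with constant
  \<open>s * D\<close>. Two separated branches have maximal distance but nearby images, and
  comparison with the lower estimate cancels \<open>s\<close>.\<close>

lemma embedding_fundamental_bound: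
  fixes e :: "nat \<Rightarrow> 'b::real_normed_vector" and f :: "nat set \<Rightarrow> 'a::real_normed_vector"
  assumes refl: "reflexive_space TYPE('a)"
    and win: "sum_win C k (0::'a)"
    and e: "normalized_seq e" "suppression_unconditional1 e"
    and s: "s > 0" and D: "D \<ge> 1"
    and f: "\<And>A B. A \<in> ksubsets UNIV k \<Longrightarrow> B \<in> ksubsets UNIV k \<Longrightarrow>
      s * d_e e k A B \<le> norm (f A - f B) \<and> norm (f A - f B) \<le> s * D * d_e e k A B"
  shows "norm (\<Sum>j<k. e j) \<le> 2 * D * (2 * C + 1)"
proof -
  obtain U :: "nat filter" where U: "U \<le> sequentially" "ultra U"
    using ultra_exists[OF sequentially_bot] by blast
  \<comment> \<open>The value 0 elsewhere keeps \<open>h\<close> bounded on all lists, including the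
    shorter or unsorted ones.\<close>
  define h where "h ms = (if sorted_wrt (<) ms \<and> length ms = k then f (set ms) else 0)" for ms
  have h: "h ms = f (set ms)" if "sorted_wrt (<) ms" "length ms = k" for ms
    using that by (simp add: h_def)
  define L where "L = s * D"
  have L: "L > 0" using s D by (simp add: L_def)
  have A0: "{..<k} \<in> ksubsets UNIV k" by (simp add: ksubsets_def)
  define K where "K = norm (f {..<k}) + L * norm (\<Sum>j<k. e j)"
  have "norm (h ms) \<le> K" for ms
  proof (cases "sorted_wrt (<) ms \<and> length ms = k")
    case True
    then have "norm (f (set ms) - f {..<k}) \<le> L * d_e e k (set ms) {..<k}"
      using f[OF strict_sorted_ksubset A0] by (simp add: L_def)
    also have "\<dots> \<le> L * norm (\<Sum>j<k. e j)"
      using L d_e_le[OF e(2)] by (intro mult_left_mono) auto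
    finally show ?thesis
      using True norm_triangle_sub[of "f (set ms)" "f {..<k}"] by (simp add: h K_def)
  next
    case False
    then have "h ms = 0" unfolding h_def by (rule if_not_P)
    then show ?thesis using L by (simp add: K_def)
  qed
  moreover have "norm (h (ms @ m # rest) - h (ms @ m' # rest)) \<le> L"
    if "sorted_wrt (<) (ms @ m # rest)" "sorted_wrt (<) (ms @ m' # rest)" "length (ms @ m # rest) = k"
    for ms m m' rest
  proof -
    have len: "length (ms @ m' # rest) = k" using that(3) by simp
    have "norm (f (set (ms @ m # rest)) - f (set (ms @ m' # rest)))
        \<le> L * d_e e k (set (ms @ m # rest)) (set (ms @ m' # rest))"
      unfolding L_def using f[OF strict_sorted_ksubset[OF that(1,3)] strict_sorted_ksubset[OF that(2) len]] by blast
    also have "\<dots> \<le> L * 1"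
      using L d_e_single_change[OF e(1) that(1,2)] by (intro mult_left_mono) auto
    finally show ?thesis unfolding h[OF that(1,3)] h[OF that(2) len] by simp
  qed
  ultimately interpret lipschitz_tree U h K k L
    using refl U L by unfold_locales auto
  obtain ms ns where len: "length ms = k" "length ns = k" and srt: "sorted_wrt (<) ms" "sorted_wrt (<) ns"
    and sep: "\<forall>p\<in>set ms. \<forall>q\<in>set ns. p < q" and le: "norm (h ms - h ns) \<le> 2 * L * (2 * C + 1)"
    using separated_branches_exist[OF win] by blast
  have "s * norm (\<Sum>j<k. e j) \<le> norm (h ms - h ns)"
    using f[OF strict_sorted_ksubset[OF srt(1) len(1)] strict_sorted_ksubset[OF srt(2) len(2)]]
    by (simp add: h len srt d_e_separated[OF srt len sep])
  also note le
  also have "2 * L * (2 * C + 1) = s * (2 * D * (2 * C + 1))" by (simp add: L_def)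
  finally show ?thesis using s by simp
qed

theorem theorem3p4:
  fixes e :: "nat \<Rightarrow> 'b::banach"
  assumes "separable_space (euclidean :: 'a::banach topology)"
    and "reflexive_space TYPE('a)"
    and "asymptotic_c0 TYPE('a)"
    and "normalized_seq e" and "suppression_unconditional1 e" and "basic_seq e"
    and "filterlim (\<lambda>k. Inf {diam_k e k M | M. infinite M}) at_top sequentially"
  shows "(SUP k. c_dist TYPE('a) e k) = \<infinity>"
proof (rule ccontr)
  assume neq: "(SUP k. c_dist TYPE('a) e k) \<noteq> \<infinity>"
  obtain C where C: "C \<ge> 0" "\<And>k. sum_win C k (0::'a)"
    using asymptotic_c0_sum_win[OF assms(3)] by blast
  \<comment> \<open>A real bound strictly above the supremum yields, for every \<open>k\<close>, an
    embedding with distortion below the same \<open>T\<close>.\<close>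
  from neq obtain T where T: "(SUP k. c_dist TYPE('a) e k) < ereal T"
    by (metis less_PInf_Ex_of_nat ereal_infty_less(1))
  have "norm (\<Sum>j<k. e j) \<le> 2 * T * (2 * C + 1)" for k
  proof -
    have "c_dist TYPE('a) e k < ereal T"
      using T by (meson SUP_upper UNIV_I le_less_trans)
    then obtain D s and f :: "nat set \<Rightarrow> 'a" where D: "D \<ge> 1" "D < T" and "s > 0"
      and f: "\<forall>A\<in>ksubsets UNIV k. \<forall>B\<in>ksubsets UNIV k.
        s * d_e e k A B \<le> norm (f A - f B) \<and> norm (f A - f B) \<le> s * D * d_e e k A B"
      unfolding c_dist_def Inf_less_iff by auto
    have "norm (\<Sum>j<k. e j) \<le> 2 * D * (2 * C + 1)"
      by (rule embedding_fundamental_bound[where f = f, OF assms(2) C(2) assms(4,5) \<open>s > 0\<close> D(1)]) (use f in blast)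
    also have "\<dots> \<le> 2 * T * (2 * C + 1)" using D C(1) by (intro mult_right_mono) auto
    finally show ?thesis .
  qed
  \<comment> \<open>The bound is independent of \<open>k\<close>, contrary to the divergence of the
    diameters.\<close>
  then have "Inf {diam_k e k M | M. infinite M} \<le> 2 * T * (2 * C + 1)" for k
    by (rule order_trans[OF Inf_diam_k_le[OF assms(5)]])
  moreover have "eventually (\<lambda>k. Inf {diam_k e k M | M. infinite M} > 2 * T * (2 * C + 1)) sequentially"
    using assms(7) by (simp add: filterlim_at_top_dense)
  ultimately show False
    by (metis (no_types, lifting) eventually_happens' linorder_not_le sequentially_bot)
qed

end
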